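(* Let $\Pi:\mathcal P\to\mathcal P$ be a map, let $\boldsymbol p\in\mathcal P$ be the underlying distribution (not necessarily satisfying $\Pi(\boldsymbol p)=\boldsymbol p$), and suppose that $\Pi$ satisfies properties (i)–(v) listed in the context. Let $d\in\{1,2\}$ and let $\hat{\boldsymbol\phi}_n=\beta^{(L_d)}_n\Pi(\hat{\boldsymbol p}_n)+(1-\beta^{(L_d)}_n)\hat{\boldsymbol p}_n$ be the stacked estimator with mixture parameter selected by leave-one-out cross-validation with loss $L_d$. Then: (a) for every $1\le k\le\infty$, $\|\hat{\boldsymbol\phi}_n-\boldsymbol p\|_k\to0$ almost surely as $n\to\infty$; (b) for every $2\le k\le\infty$, $n^{1/2}\|\hat{\boldsymbol\phi}_n-\boldsymbol p\|_k=O_p(1)$; (c) if in addition $\sum_{j=0}^\infty\sqrt{p_j}<\infty$, then $n^{1/2}\|\hat{\boldsymbol\phi}_n-\boldsymbol p\|_1=O_p(1)$.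
   Context: Notation. $\mathcal S=\{\boldsymbol s_0,\boldsymbol s_1,\dots\}$ is a countable set, and vectors are indexed by $j\in\mathbb N=\{0,1,\dots\}$ (coordinate $j$ corresponds to $\boldsymbol s_j$). $\mathcal P=\{\boldsymbol f\in\ell_1:\ f_j\ge0,\ \sum_jf_j=1\}$. $\|\cdot\|_k$ is the $\ell_k$-norm ($k\in\{1,2,\dots\}\cup\{\infty\}$), $\langle\cdot,\cdot\rangle$ the $\ell_2$ inner product. For real random variables $b_n$, $b_n=O_p(n^q)$ means: for every $\varepsilon>0$ there are finite $M,N>0$ with $\mathbb P(n^{-q}|b_n|>M)<\varepsilon$ for all $n>N$. Data. $\boldsymbol z_1,\boldsymbol z_2,\dots$ are i.i.d. $\mathcal S$-valued with p.m.f. $\boldsymbol p\in\mathcal P$. For each $n$: $x_j=\sum_{i=1}^n1\{\boldsymbol z_i=\boldsymbol s_j\}$, $t_n=\sup\{j:x_j>0\}$, $\hat p_{n,j}=x_j/n$. For $n\ge2$ and $j$ with $x_j>0$: $\hat{\boldsymbol p}^{\backslash[j]}_n=(\boldsymbol x-\boldsymbol\sigma^{[j]})/(n-1)$, where $\boldsymbol\sigma^{[j]}$ has entry $1$ at index $j$ and $0$ elsewhere, and $\hat{\boldsymbol g}^{\backslash[j]}_n=\Pi(\hat{\boldsymbol p}^{\backslash[j]}_n)$; for $j$ with $x_j=0$ put $\hat{\boldsymbol g}^{\backslash[j]}_n=0$ (irrelevant below). Mixture parameters selected by leave-one-out cross-validation. For loss $L_1$: $\beta^{(L_1)}_n=0$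 if $\sum_{j=0}^{t_n}\{(x_j-n\hat g^{\backslash[j]}_{n,j})^2+(n+1)\hat g^{\backslash[j]}_{n,j}(x_j-n\hat g^{\backslash[j]}_{n,j})+n(\hat g^{\backslash[j]}_{n,j})^2\}\ge n$, and $\beta^{(L_1)}_n=1$ otherwise. For loss $L_2$: $\beta^{(L_2)}_n=b_n/a_n$ if $a_n\neq0$ and $0\le b_n\le a_n$; $\beta^{(L_2)}_n=0$ if $a_n=0$ or $b_n<0$; $\beta^{(L_2)}_n=1$ otherwise, where $$a_n=n-\sum_{j=0}^{t_n}x_j\Big\{2(x_j-\hat g^{\backslash[j]}_{n,j}(n-1))-\sum_{k=0}^{t_n}(x_k-(n-1)\hat g^{\backslash[j]}_{n,k})^2\Big\},$$ $$b_n=n^2-\sum_{j=0}^{t_n}x_j^2+(n-1)\sum_{j=0}^{t_n}x_j\sum_{k=0}^{t_n}x_k(\hat g^{\backslash[k]}_{n,k}-\hat g^{\backslash[j]}_{n,k}).$$ Properties assumed of $\Pi$: (i) $\Pi$ is continuous from $\ell_2$ to $\ell_2$ (i.e. on $\mathcal P$ with the $\ell_2$-norm). (ii) $\Pi$ is a contraction for the $\ell_\infty$-norm: $\|\Pi(\boldsymbol f)-\Pi(\boldsymbol h)\|_\infty\le\|\boldsymbol f-\boldsymbol h\|_\infty$ for $\boldsymbol f,\boldsymbol h\in\mathcal P$. (iii) $\langle\Pi(\boldsymbol f),\boldsymbol f-\Pi(\boldsymbol f)\rangle=0$ and $\langle\boldsymbol f,\boldsymbol f-\Pi(\boldsymbol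 f)\rangle\ge0$ for every $\boldsymbol f\in\mathcal P$. (iv) There is a real sequence $c_n\to1$ such that for any frequency data $\boldsymbol x$ of size $n$, $c_n\hat{\boldsymbol\gamma}_n\le\Pi(\hat{\boldsymbol p}_n)$ coordinatewise, where $\hat\gamma_{n,j}=\Pi(\hat{\boldsymbol p}^{\backslash[j]}_n)_j$ if $x_j>0$ and $\hat\gamma_{n,j}=0$ otherwise. (v) If the true distribution satisfies $\Pi(\boldsymbol p)=\boldsymbol p$, then $n^{1/2}\|\Pi(\hat{\boldsymbol p}_n)-\boldsymbol p\|_k=O_p(1)$ for $2\le k\le\infty$, and if in addition $\sum_{j}\sqrt{p_j}<\infty$, then $n^{1/2}\|\Pi(\hat{\boldsymbol p}_n)-\boldsymbol p\|_1=O_p(1)$. *)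

theory Defs
  imports "HOL-Probability.Probability"
begin

definition prob_vecs :: "(nat \<Rightarrow> real) set" where
  "prob_vecs = {f. (\<forall>j. 0 \<le> f j) \<and> f sums 1}"

text \<open>The norm of \<open>\<ell>\<^sub>k\<close> for \<open>k \<in> {1, 2, \<dots>} \<union> {\<infinity>}\<close>; meaningful only for vectors
  in \<open>\<ell>\<^sub>k\<close>. It is only applied to differences of summable vectors, which lie in every \<open>\<ell>\<^sub>k\<close>.\<close>

definition lnorm :: "enat \<Rightarrow> (nat \<Rightarrow> real) \<Rightarrow> real" where
  "lnorm k f = (case k of enat q \<Rightarrow> root q (\<Sum>j. \<bar>f j\<bar> ^ q) | \<infinity> \<Rightarrow> (SUP j. \<bar>f j\<bar>))"

definition linner :: "(nat \<Rightarrow> real) \<Rightarrow> (nat \<Rightarrow> real) \<Rightarrow> real" where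
  "linner f h = (\<Sum>j. f j * h j)"

text \<open>\<open>bigOp M b q\<close> is the stochastic order relation \<open>b\<^sub>n = O\<^sub>p(n\<^sup>q)\<close>.\<close>

definition bigOp :: "'w measure \<Rightarrow> (nat \<Rightarrow> 'w \<Rightarrow> real) \<Rightarrow> real \<Rightarrow> bool" where
  "bigOp M b q \<longleftrightarrow> (\<forall>\<epsilon>>0. \<exists>K>0. \<exists>N>0. \<forall>n>N.
     measure M {\<omega> \<in> space M. real n powr (- q) * \<bar>b n \<omega>\<bar> > K} < \<epsilon>)"

text \<open>An i.i.d. sequence indexed from \<open>1\<close>, with values in the countable set \<open>range s\<close> enumerated by
  \<open>s\<close>, and with probability mass function \<open>p\<close>. Measurability is part of \<open>indep_vars\<close>.\<close>

definition iid_sample ::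
  "'w measure \<Rightarrow> (nat \<Rightarrow> 's) \<Rightarrow> (nat \<Rightarrow> real) \<Rightarrow> (nat \<Rightarrow> 'w \<Rightarrow> 's) \<Rightarrow> bool" where
  "iid_sample M s p z \<longleftrightarrow>
     prob_space.indep_vars M (\<lambda>_. count_space (range s)) z {1..} \<and>
     (\<forall>i\<ge>1. \<forall>j. measure M {\<omega> \<in> space M. z i \<omega> = s j} = p j)"

definition freq :: "(nat \<Rightarrow> 's) \<Rightarrow> (nat \<Rightarrow> 'w \<Rightarrow> 's) \<Rightarrow> nat \<Rightarrow> 'w \<Rightarrow> nat \<Rightarrow> nat" where
  "freq s z n \<omega> j = card {i \<in> {1..n}. z i \<omega> = s j}"

text \<open>The quantities below are deterministic functions of the sample size \<open>n\<close> and the frequency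
  vector \<open>x\<close>.\<close>

definition freq_data :: "nat \<Rightarrow> (nat \<Rightarrow> nat) \<Rightarrow> bool" where
  "freq_data n x \<longleftrightarrow> finite {j. x j > 0} \<and> (\<Sum>j | x j > 0. x j) = n"

definition t_max :: "(nat \<Rightarrow> nat) \<Rightarrow> nat" where
  "t_max x = Sup {j. x j > 0}"

definition p_hat :: "nat \<Rightarrow> (nat \<Rightarrow> nat) \<Rightarrow> nat \<Rightarrow> real" where
  "p_hat n x j = real (x j) / real n"

definition p_loo :: "nat \<Rightarrow> (nat \<Rightarrow> nat) \<Rightarrow> nat \<Rightarrow> nat \<Rightarrow> real" where
  "p_loo n x j k = (real (x k) - (if k = j then 1 else 0)) / (real n - 1)"

text \<open>The first index argument \<open>j\<close> of \<open>p_loo\<close> and \<open>g_loo\<close> is the cell from which one observation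
  is removed. The value \<open>0\<close> outside \<open>n \<ge> 2\<close>, \<open>x j > 0\<close> is a convention.\<close>

definition g_loo ::
  "((nat \<Rightarrow> real) \<Rightarrow> nat \<Rightarrow> real) \<Rightarrow> nat \<Rightarrow> (nat \<Rightarrow> nat) \<Rightarrow> nat \<Rightarrow> nat \<Rightarrow> real" where
  "g_loo G n x j = (if n \<ge> 2 \<and> x j > 0 then G (p_loo n x j) else (\<lambda>_. 0))"

definition beta_L1 ::
  "((nat \<Rightarrow> real) \<Rightarrow> nat \<Rightarrow> real) \<Rightarrow> nat \<Rightarrow> (nat \<Rightarrow> nat) \<Rightarrow> real" where
  "beta_L1 G n x =
    (if (\<Sum>j = 0..t_max x.
           (real (x j) - real n * g_loo G n x j j)\<^sup>2
           + (real n + 1) * g_loo G n x j j * (real (x j) - real n * g_loo G n x j j)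
           + real n * (g_loo G n x j j)\<^sup>2) \<ge> real n
     then 0 else 1)"

definition a_L2 ::
  "((nat \<Rightarrow> real) \<Rightarrow> nat \<Rightarrow> real) \<Rightarrow> nat \<Rightarrow> (nat \<Rightarrow> nat) \<Rightarrow> real" where
  "a_L2 G n x =
     real n - (\<Sum>j = 0..t_max x. real (x j) *
       (2 * (real (x j) - g_loo G n x j j * (real n - 1))
        - (\<Sum>k = 0..t_max x. (real (x k) - (real n - 1) * g_loo G n x j k)\<^sup>2)))"

definition b_L2 ::
  "((nat \<Rightarrow> real) \<Rightarrow> nat \<Rightarrow> real) \<Rightarrow> nat \<Rightarrow> (nat \<Rightarrow> nat) \<Rightarrow> real" where
  "b_L2 G n x =
     (real n)\<^sup>2 - (\<Sum>j = 0..t_max x. (real (x j))\<^sup>2)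
     + (real n - 1) * (\<Sum>j = 0..t_max x. real (x j) *
         (\<Sum>k = 0..t_max x. real (x k) * (g_loo G n x k k - g_loo G n x j k)))"

definition beta_L2 ::
  "((nat \<Rightarrow> real) \<Rightarrow> nat \<Rightarrow> real) \<Rightarrow> nat \<Rightarrow> (nat \<Rightarrow> nat) \<Rightarrow> real" where
  "beta_L2 G n x =
    (if a_L2 G n x \<noteq> 0 \<and> 0 \<le> b_L2 G n x \<and> b_L2 G n x \<le> a_L2 G n x
       then b_L2 G n x / a_L2 G n x
     else if a_L2 G n x = 0 \<or> b_L2 G n x < 0 then 0
     else 1)"

datatype loss = L1 | L2

fun beta ::
  "loss \<Rightarrow> ((nat \<Rightarrow> real) \<Rightarrow> nat \<Rightarrow> real) \<Rightarrow> nat \<Rightarrow> (nat \<Rightarrow> nat) \<Rightarrow> real" where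
  "beta L1 = beta_L1"
| "beta L2 = beta_L2"

definition stacked ::
  "loss \<Rightarrow> ((nat \<Rightarrow> real) \<Rightarrow> nat \<Rightarrow> real) \<Rightarrow> nat \<Rightarrow> (nat \<Rightarrow> nat) \<Rightarrow> nat \<Rightarrow> real" where
  "stacked d G n x j =
     beta d G n x * G (p_hat n x) j + (1 - beta d G n x) * p_hat n x j"

end

theory Submission
  imports Defs "HOL-Real_Asymp.Real_Asymp"
begin

text \<open>If \<open>G p = p\<close>, the stacked estimator is a convex combination of two estimators that both
  converge to \<open>p\<close> at rate \<open>1 / sqrt n\<close>, whatever the weight. If \<open>G p \<noteq> p\<close>, the cross-validated
  weight \<open>\<beta>\<^sub>n\<close> satisfies \<open>sqrt n * \<beta>\<^sub>n \<rightarrow> 0\<close> almost surely, so the estimator inherits the rate of the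
  empirical distribution \<open>p\<^sub>n\<close>. The contraction property controls the weight: removing one
  observation moves \<open>G p\<^sub>n\<close> by at most \<open>1 / (n - 1)\<close> in every coordinate. For the first loss, the
  criterion is therefore at least \<open>n\<^sup>2 \<langle>p\<^sub>n, p\<^sub>n - G p\<^sub>n\<rangle> - n\<close>, and by orthogonality the inner product
  tends to \<open>\<parallel>p - G p\<parallel>\<^sup>2 > 0\<close>. For the second loss, the denominator \<open>a\<^sub>n\<close> is at least of order \<open>n\<^sup>3\<close>,
  whereas the numerator \<open>b\<^sub>n\<close> is at most \<open>3 n\<^sup>2\<close>.\<close>

section \<open>Norms of differences of probability vectors\<close>

lemma lnorm_one: "lnorm 1 f = (\<Sum>j. \<bar>f j\<bar>)"
  by (simp add: lnorm_def one_enat_def)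

lemma lnorm_two: "lnorm 2 f = sqrt (\<Sum>j. (f j)\<^sup>2)"
  by (simp add: lnorm_def numeral_eq_enat sqrt_def)

text \<open>Each \<open>\<bar>f j\<bar>\<close> is at most the whole sum \<open>S\<close>, so the
  powers are dominated by \<open>S ^ (q - 1) * \<bar>f j\<bar>\<close>. This puts summable vectors
  into every l_q, where \<open>lnorm\<close> is meaningful.\<close>

lemma summable_abs_power:
  fixes f :: "nat \<Rightarrow> real"
  assumes "summable (\<lambda>j. \<bar>f j\<bar>)" "1 \<le> q"
  shows "summable (\<lambda>j. \<bar>f j\<bar> ^ q)"
proof -
  have "\<bar>f j\<bar> \<le> (\<Sum>j. \<bar>f j\<bar>)" for j
    using sum_le_suminf[OF assms(1), of "{j}"] by simp
  then have "\<bar>f j\<bar> ^ q \<le> (\<Sum>j. \<bar>f j\<bar>) ^ (q - 1) * \<bar>f j\<bar>" for j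
    using assms(2) by (cases q) (auto intro!: mult_right_mono power_mono simp: power_Suc2 simp del: power_Suc)
  then show ?thesis
    by (intro summable_comparison_test'[OF summable_mult[OF assms(1)], of 0 _ "(\<Sum>j. \<bar>f j\<bar>) ^ (q - 1)"])
      simp
qed

lemma abs_le_lnorm:
  assumes "summable (\<lambda>j. \<bar>f j\<bar>)" "1 \<le> k"
  shows "\<bar>f j\<bar> \<le> lnorm k f"
proof (cases k)
  case (enat q)
  with assms(2) have q: "1 \<le> q" by (simp add: one_enat_def)
  have "\<bar>f j\<bar> ^ q \<le> (\<Sum>j. \<bar>f j\<bar> ^ q)"
    using sum_le_suminf[OF summable_abs_power[OF assms(1) q], of "{j}"] by simp
  then have "root q (\<bar>f j\<bar> ^ q) \<le> root q (\<Sum>j. \<bar>f j\<bar> ^ q)"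
    using q by (intro real_root_le_mono) auto
  with q enat show ?thesis by (simp add: lnorm_def real_root_power_cancel)
next
  case infinity
  \<comment> \<open>A supremum of reals is informative only for a set that is bounded above; the
    total sum is a bound.\<close>
  have "bdd_above (range (\<lambda>j. \<bar>f j\<bar>))"
    using sum_le_suminf[OF assms(1), of "{j}" for j]
    by (intro bdd_aboveI[of _ "\<Sum>j. \<bar>f j\<bar>"]) auto
  with infinity show ?thesis
    by (auto simp: lnorm_def intro: cSUP_upper)
qed

lemma lnorm_inf_le: "(\<And>j. \<bar>f j\<bar> \<le> B) \<Longrightarrow> lnorm \<infinity> f \<le> B"
  by (auto simp: lnorm_def intro: cSUP_least)

lemma lnorm_nonneg:
  assumes "summable (\<lambda>j. \<bar>f j\<bar>)" "1 \<le> k"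
  shows "0 \<le> lnorm k f"
  using abs_le_lnorm[OF assms, of 0] by linarith

text \<open>Reduces convergence and rates to the exponents 1 and 2. If \<open>N\<close> is the
  l_q-norm, then \<open>\<bar>f j\<bar> \<le> N\<close>, hence
  \<open>\<bar>f j\<bar> ^ r \<le> N ^ (r - q) * \<bar>f j\<bar> ^ q\<close>, and the right-hand
  sides sum to \<open>N ^ r\<close>.\<close>

lemma lnorm_antimono:
  assumes f: "summable (\<lambda>j. \<bar>f j\<bar>)" and l: "1 \<le> l" "l \<le> k"
  shows "lnorm k f \<le> lnorm l f"
proof (cases k)
  case infinity
  then show ?thesis by (simp add: lnorm_inf_le abs_le_lnorm[OF f l(1)])
next
  case (enat r)
  with l obtain q where q: "l = enat q" "1 \<le> q" "q \<le> r"
    by (cases l) (auto simp: one_enat_def)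
  define N where "N = lnorm l f"
  have N: "\<bar>f j\<bar> \<le> N" for j
    unfolding N_def by (rule abs_le_lnorm[OF f l(1)])
  have N0: "0 \<le> N" using lnorm_nonneg[OF f l(1)] by (simp add: N_def)
  have sq: "summable (\<lambda>j. \<bar>f j\<bar> ^ q)" by (rule summable_abs_power[OF f q(2)])
  have Nq: "N ^ q = (\<Sum>j. \<bar>f j\<bar> ^ q)"
    unfolding N_def q(1) lnorm_def using q(2) by (simp add: suminf_nonneg sq)
  have "(\<Sum>j. \<bar>f j\<bar> ^ r) \<le> (\<Sum>j. N ^ (r - q) * \<bar>f j\<bar> ^ q)"
  proof (rule suminf_le)
    show "\<bar>f j\<bar> ^ r \<le> N ^ (r - q) * \<bar>f j\<bar> ^ q" for j
    proof -
      have "\<bar>f j\<bar> ^ r = \<bar>f j\<bar> ^ (r - q) * \<bar>f j\<bar> ^ q"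
        using q(3) by (simp flip: power_add)
      also have "\<dots> \<le> N ^ (r - q) * \<bar>f j\<bar> ^ q"
        using N by (intro mult_right_mono power_mono) auto
      finally show ?thesis .
    qed
  qed (use q in \<open>auto intro!: summable_mult sq summable_abs_power[OF f]\<close>)
  also have "\<dots> = N ^ r"
    using q(3) by (simp add: suminf_mult[OF sq] flip: Nq power_add)
  finally have "root r (\<Sum>j. \<bar>f j\<bar> ^ r) \<le> root r (N ^ r)"
    using q by (intro real_root_le_mono) auto
  also have "\<dots> = N" using q N0 by (intro real_root_power_cancel) auto
  finally show ?thesis by (simp add: lnorm_def enat N_def)
qed

text \<open>Minkowski's inequality for the finite \<open>L2_set\<close>, carried to the limit of the
  partial sums.\<close>

lemma lnorm_two_triangle:
  assumes "summable (\<lambda>j. \<bar>f j\<bar>)" "summable (\<lambda>j. \<bar>g j\<bar>)"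
  shows "lnorm 2 (\<lambda>j. f j + g j) \<le> lnorm 2 f + lnorm 2 g"
proof -
  have lim: "(\<lambda>n. L2_set h {..<n}) \<longlonglongrightarrow> lnorm 2 h" if "summable (\<lambda>j. \<bar>h j\<bar>)" for h
    unfolding L2_set_def lnorm_two
    using summable_abs_power[OF that, of 2] by (intro tendsto_real_sqrt summable_LIMSEQ) simp
  have "summable (\<lambda>j. \<bar>f j + g j\<bar>)"
    by (rule summable_comparison_test'[OF summable_add[OF assms], of 0]) auto
  from lim[OF this] tendsto_add[OF lim[OF assms(1)] lim[OF assms(2)]] show ?thesis
    by (rule LIMSEQ_le) (simp add: L2_set_triangle_ineq)
qed

lemma lnorm_triangle:
  assumes "l = 1 \<or> l = 2" "summable (\<lambda>j. \<bar>f j\<bar>)" "summable (\<lambda>j. \<bar>g j\<bar>)"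
  shows "lnorm l (\<lambda>j. f j + g j) \<le> lnorm l f + lnorm l g"
  using assms(1)
proof
  have s: "summable (\<lambda>j. \<bar>f j + g j\<bar>)"
    by (rule summable_comparison_test'[OF summable_add[OF assms(2,3)], of 0]) auto
  assume "l = 1"
  then show ?thesis
    using s assms(2,3) by (simp add: lnorm_one suminf_add summable_add suminf_le abs_triangle_ineq)
qed (use lnorm_two_triangle[OF assms(2,3)] in simp)

lemma lnorm_mult:
  assumes "l = 1 \<or> l = 2" "summable (\<lambda>j. \<bar>f j\<bar>)"
  shows "lnorm l (\<lambda>j. c * f j) = \<bar>c\<bar> * lnorm l f"
  using assms summable_abs_power[OF assms(2), of 2]
  by (auto simp: lnorm_one lnorm_two abs_mult power_mult_distrib suminf_mult real_sqrt_mult)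

section \<open>Probability vectors and their differences\<close>

lemma prob_vecs_nonneg: "f \<in> prob_vecs \<Longrightarrow> 0 \<le> f j"
  and prob_vecs_sums: "f \<in> prob_vecs \<Longrightarrow> f sums 1"
  and prob_vecs_suminf: "f \<in> prob_vecs \<Longrightarrow> (\<Sum>j. f j) = 1"
  and prob_vecs_summable: "f \<in> prob_vecs \<Longrightarrow> summable f"
  by (auto simp: prob_vecs_def sums_iff)

lemma prob_vecs_le_one: "f j \<le> 1" if "f \<in> prob_vecs"
  using sum_le_suminf[OF prob_vecs_summable[OF that], of "{j}"]
    prob_vecs_nonneg[OF that] prob_vecs_suminf[OF that] by simp

lemma prob_vecs_diff_summable:
  assumes "f \<in> prob_vecs" "h \<in> prob_vecs"
  shows "summable (\<lambda>j. \<bar>f j - h j\<bar>)"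
  using prob_vecs_nonneg[OF assms(1)] prob_vecs_nonneg[OF assms(2)]
  by (intro summable_comparison_test'[OF summable_add[OF assms[THEN prob_vecs_summable]], of 0])
    (simp add: abs_le_iff add_increasing add_increasing2)

lemma lnorm_one_prob_vecs_diff_le:
  assumes "f \<in> prob_vecs" "h \<in> prob_vecs"
  shows "lnorm 1 (\<lambda>j. f j - h j) \<le> 2"
proof -
  have "(\<Sum>j. \<bar>f j - h j\<bar>) \<le> (\<Sum>j. f j + h j)"
    using prob_vecs_nonneg[OF assms(1)] prob_vecs_nonneg[OF assms(2)]
    by (intro suminf_le prob_vecs_diff_summable assms summable_add prob_vecs_summable)
      (simp add: abs_le_iff add_increasing add_increasing2)
  also have "\<dots> = 2"
    using assms by (simp add: suminf_add[symmetric] prob_vecs_summable prob_vecs_suminf)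
  finally show ?thesis by (simp add: lnorm_one)
qed

text \<open>Scheffe's lemma: \<open>\<bar>f - h\<bar> = f - h + 2 max 0 (h - f)\<close>, and the last term is dominated
  by \<open>h\<close>.\<close>

lemma prob_vecs_tendsto_lnorm_one:
  assumes f: "\<And>n. n \<ge> n0 \<Longrightarrow> f n \<in> prob_vecs" and h: "h \<in> prob_vecs"
    and lim: "\<And>j. (\<lambda>n. f n j) \<longlonglongrightarrow> h j"
  shows "(\<lambda>n. lnorm 1 (\<lambda>j. f n j - h j)) \<longlonglongrightarrow> 0"
proof -
  \<comment> \<open>Domination by \<open>h\<close> rests on \<open>f n k \<ge> 0\<close>, which
    holds from \<open>n0\<close> on; the threshold for \<open>k\<close> is arbitrary.\<close>
  have ev: "eventually (\<lambda>(k, n). norm (max 0 (h k - f n k)) \<le> h k) (at_top \<times>\<^sub>F sequentially)"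
    unfolding eventually_prod_sequentially
    by (rule exI[of _ n0]) (use prob_vecs_nonneg[OF f] prob_vecs_nonneg[OF h] in auto)
  have "(\<lambda>n. max 0 (h k - f n k)) \<longlonglongrightarrow> max 0 (h k - h k)" for k
    by (intro tendsto_intros lim)
  then have "(\<lambda>n. max 0 (h k - f n k)) \<longlonglongrightarrow> 0" for k by simp
  from tannerys_theorem[OF this ev prob_vecs_summable[OF h]]
  have T: "(\<lambda>n. \<Sum>k. max 0 (h k - f n k)) \<longlonglongrightarrow> 0"
    and S: "eventually (\<lambda>n. summable (\<lambda>k. norm (max 0 (h k - f n k)))) sequentially"
    by auto
  have "eventually (\<lambda>n. 2 * (\<Sum>k. max 0 (h k - f n k)) = lnorm 1 (\<lambda>j. f n j - h j)) sequentially"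
    using S eventually_ge_at_top[of n0]
  proof eventually_elim
    case (elim n)
    have s: "summable (\<lambda>k. max 0 (h k - f n k))" using elim(1) by simp
    note fn = f[OF elim(2)]
    have "lnorm 1 (\<lambda>j. f n j - h j) = (\<Sum>j. f n j - h j + 2 * max 0 (h j - f n j))"
      unfolding lnorm_one by (intro arg_cong[where f = suminf] ext) (auto simp: max_def)
    also have "\<dots> = (\<Sum>j. f n j) - (\<Sum>j. h j) + 2 * (\<Sum>j. max 0 (h j - f n j))"
      by (simp add: suminf_add[symmetric] suminf_diff[symmetric] suminf_mult s
          prob_vecs_summable fn h summable_diff summable_mult)
    finally show ?case by (simp add: prob_vecs_suminf fn h)
  qed
  from tendsto_cong[OF this] tendsto_mult_left[OF T, of 2] show ?thesis by simp
qed

section \<open>Cross-validation weights for fixed frequency data\<close>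

lemma freq_data_p_hat:
  assumes "freq_data n x" "1 \<le> n"
  shows "p_hat n x \<in> prob_vecs"
proof -
  have "(\<lambda>j. real (x j)) sums (\<Sum>j | x j > 0. real (x j))"
    using assms(1) by (intro sums_finite) (auto simp: freq_data_def)
  then have "(\<lambda>j. real (x j)) sums real n"
    using assms(1) by (simp add: freq_data_def flip: of_nat_sum)
  from sums_divide[OF this, of "real n"] assms(2) show ?thesis
    by (simp add: prob_vecs_def p_hat_def[abs_def])
qed

lemma freq_data_p_loo:
  assumes "freq_data n x" "2 \<le> n" "x j > 0"
  shows "p_loo n x j \<in> prob_vecs"
proof -
  have "(\<lambda>j. real (x j)) sums (\<Sum>j | x j > 0. real (x j))"
    using assms(1) by (intro sums_finite) (auto simp: freq_data_def)
  then have "(\<lambda>j. real (x j)) sums real n"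
    using assms(1) by (simp add: freq_data_def flip: of_nat_sum)
  from sums_diff[OF this sums_single[of j "\<lambda>_. 1"]]
  have "(\<lambda>k. real (x k) - (if k = j then 1 else 0)) sums (real n - 1)" .
  from sums_divide[OF this, of "real n - 1"] assms show ?thesis
    by (auto simp: prob_vecs_def p_loo_def[abs_def])
qed

lemma freq_data_le: "x j \<le> n" if "freq_data n x"
proof (cases "x j = 0")
  case False
  then have "x j \<le> (\<Sum>j | x j > 0. x j)"
    using that by (intro member_le_sum) (auto simp: freq_data_def)
  then show ?thesis using that by (simp add: freq_data_def)
qed simp

text \<open>Over the common denominator \<open>n * (n - 1)\<close> the numerator is
  \<open>x k\<close>, less \<open>n\<close> in the cell \<open>j\<close>; since
  \<open>x k \<le> n\<close>, its absolute value is at most \<open>n\<close>.\<close>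

lemma p_loo_close:
  assumes "freq_data n x" "2 \<le> n"
  shows "\<bar>p_loo n x j k - p_hat n x k\<bar> \<le> 1 / (real n - 1)"
proof -
  have "p_loo n x j k - p_hat n x k = (real (x k) - (if k = j then real n else 0)) / (real n * (real n - 1))"
    using assms(2) by (auto simp: p_loo_def p_hat_def field_simps)
  also have "\<bar>\<dots>\<bar> = \<bar>real (x k) - (if k = j then real n else 0)\<bar> / (real n * (real n - 1))"
    using assms(2) by (simp add: abs_mult)
  also have "\<dots> \<le> real n / (real n * (real n - 1))"
    using assms(2) freq_data_le[OF assms(1), of k]
    by (intro divide_right_mono) auto
  finally show ?thesis using assms(2) by simp
qed

lemma freq_data_le_t_max: "j \<le> t_max x" if "freq_data n x" "x j > 0"
  using that by (auto simp: t_max_def freq_data_def intro!: cSup_upper bdd_above_finite)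

text \<open>Converts between series over all cells and the sums up to \<open>t_max x\<close> in the
  cross-validation criteria.\<close>

lemma freq_data_sum_t_max:
  assumes "freq_data n x" "\<And>j. x j = 0 \<Longrightarrow> F j = 0"
  shows "F sums (\<Sum>j = 0..t_max x. F j)"
proof (rule sums_finite)
  fix j assume "j \<notin> {0..t_max x}"
  then have "x j = 0" using freq_data_le_t_max[OF assms(1), of j] by auto
  then show "F j = 0" by (rule assms(2))
qed simp

lemma freq_data_sum: "(\<Sum>j = 0..t_max x. real (x j)) = real n" if "freq_data n x"
proof -
  have "(\<Sum>j = 0..t_max x. real (x j)) = (\<Sum>j | x j > 0. real (x j))"
    using that freq_data_le_t_max[OF that] by (intro sum.mono_neutral_right) auto
  then show ?thesis using that by (simp add: freq_data_def flip: of_nat_sum)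
qed

lemma beta_bounds: "0 \<le> beta d G n x" "beta d G n x \<le> 1"
  by (cases d; auto simp: beta_L1_def beta_L2_def divide_le_eq_1)+

lemma prob_vecs_convex:
  assumes "f \<in> prob_vecs" "h \<in> prob_vecs" "0 \<le> c" "c \<le> 1"
  shows "(\<lambda>j. c * f j + (1 - c) * h j) \<in> prob_vecs"
proof -
  have "(\<lambda>j. c * f j + (1 - c) * h j) sums (c * 1 + (1 - c) * 1)"
    using assms by (intro sums_add sums_mult prob_vecs_sums)
  with assms show ?thesis by (simp add: prob_vecs_def)
qed

text \<open>\<open>\<langle>f, f - h\<rangle> = \<parallel>f - h\<parallel>\<^sup>2 + \<langle>h, f
  - h\<rangle>\<close>; the last term is 0 by orthogonality, and the square is positive because the
  vectors differ in some cell.\<close>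

lemma linner_diff_pos:
  assumes f: "f \<in> prob_vecs" and h: "h \<in> prob_vecs" and "h \<noteq> f"
    and orth: "linner h (f - h) = 0"
  shows "0 < linner f (f - h)"
proof -
  have abs: "summable (\<lambda>j. \<bar>f j - h j\<bar>)" by (rule prob_vecs_diff_summable[OF f h])
  have s: "summable (\<lambda>j. (f j - h j)\<^sup>2)" using summable_abs_power[OF abs, of 2] by simp
  have s': "summable (\<lambda>j. h j * (f j - h j))"
  proof (rule summable_comparison_test'[OF abs, of 0])
    show "norm (h j * (f j - h j)) \<le> \<bar>f j - h j\<bar>" for j
      using mult_right_mono[OF prob_vecs_le_one[OF h, of j], of "\<bar>f j - h j\<bar>"] prob_vecs_nonneg[OF h, of j]
      by (simp add: abs_mult)
  qed
  obtain k where "h k \<noteq> f k" using \<open>h \<noteq> f\<close> by auto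
  then have "0 < (\<Sum>j. (f j - h j)\<^sup>2)"
    by (intro suminf_pos2[OF s, of k]) auto
  also have "\<dots> = (\<Sum>j. (f j - h j)\<^sup>2) + (\<Sum>j. h j * (f j - h j))"
    using orth by (simp add: linner_def)
  also have "\<dots> = linner f (f - h)"
    unfolding linner_def suminf_add[OF s s'] by (simp add: power2_eq_square algebra_simps)
  finally show ?thesis .
qed

section \<open>Weights obtained from a contraction for the supremum norm\<close>

locale linf_contraction =
  fixes G :: "(nat \<Rightarrow> real) \<Rightarrow> nat \<Rightarrow> real"
  assumes maps: "f \<in> prob_vecs \<Longrightarrow> G f \<in> prob_vecs"
    and contraction: "f \<in> prob_vecs \<Longrightarrow> h \<in> prob_vecs \<Longrightarrow>
          lnorm \<infinity> (G f - G h) \<le> lnorm \<infinity> (f - h)"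
begin

lemma contraction_le:
  assumes "f \<in> prob_vecs" "h \<in> prob_vecs" "\<And>k. \<bar>f k - h k\<bar> \<le> B"
  shows "\<bar>G f k - G h k\<bar> \<le> B"
proof -
  have "\<bar>(G f - G h) k\<bar> \<le> lnorm \<infinity> (G f - G h)"
    using prob_vecs_diff_summable[OF assms(1,2)[THEN maps]] by (intro abs_le_lnorm) auto
  also have "\<dots> \<le> lnorm \<infinity> (f - h)" by (rule contraction[OF assms(1,2)])
  also have "\<dots> \<le> B" using assms(3) by (intro lnorm_inf_le) simp
  finally show ?thesis by simp
qed

lemma contraction_lnorm_one:
  assumes "f \<in> prob_vecs" "h \<in> prob_vecs"
  shows "\<bar>G f k - G h k\<bar> \<le> lnorm 1 (\<lambda>j. f j - h j)"
proof (rule contraction_le[OF assms])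
  show "\<bar>f j - h j\<bar> \<le> lnorm 1 (\<lambda>j. f j - h j)" for j
    using abs_le_lnorm[OF prob_vecs_diff_summable[OF assms] order_refl, of j] by simp
qed

text \<open>The contraction carries \<open>p_loo_close\<close> over to the images under
  \<open>G\<close>. The estimates below use it to replace every leave-one-out value by a value of
  \<open>G (p_hat n x)\<close>.\<close>

lemma g_loo_close:
  assumes "freq_data n x" "2 \<le> n" "x j > 0"
  shows "\<bar>g_loo G n x j k - G (p_hat n x) k\<bar> \<le> 1 / (real n - 1)"
proof -
  have "p_hat n x \<in> prob_vecs" using assms by (intro freq_data_p_hat) auto
  from contraction_le[OF freq_data_p_loo[OF assms] this p_loo_close[OF assms(1,2)]]
  show ?thesis using assms by (simp add: g_loo_def)
qed

text \<open>Each coordinate of \<open>G\<close> is 1-Lipschitz for the l_1-norm, which dominates the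
  supremum norm.\<close>

lemma G_tendsto:
  assumes f: "\<And>n. n \<ge> n0 \<Longrightarrow> f n \<in> prob_vecs" and h: "h \<in> prob_vecs"
    and lim: "(\<lambda>n. lnorm 1 (\<lambda>j. f n j - h j)) \<longlonglongrightarrow> 0"
  shows "(\<lambda>n. G (f n) k) \<longlonglongrightarrow> G h k"
proof -
  have "(\<lambda>n. G (f n) k - G h k) \<longlonglongrightarrow> 0"
  proof (rule Lim_null_comparison[OF _ lim])
    show "eventually (\<lambda>n. norm (G (f n) k - G h k) \<le> lnorm 1 (\<lambda>j. f n j - h j)) sequentially"
      using eventually_ge_at_top[of n0]
    proof eventually_elim
      case (elim n)
      from contraction_lnorm_one[OF f[OF elim] h, of k] show ?case by simp
    qed
  qed
  then show ?thesis by (rule LIM_zero_cancel)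
qed

text \<open>In the summand of the criterion the squares of the leave-one-out value \<open>g\<close>
  cancel, leaving \<open>(x j)\<^sup>2 - (n - 1) * x j * g\<close>. Passing from \<open>g\<close> to
  \<open>G (p_hat n x) j\<close> costs at most \<open>x j\<close>, in total \<open>n\<close>. With
  \<open>D\<close> the inner product in \<open>large\<close>, the criterion is thus at least
  \<open>n\<^sup>2 * D - n\<close>.\<close>

lemma beta_L1_eq_0:
  assumes x: "freq_data n x" "2 \<le> n"
    and large: "2 \<le> real n * linner (p_hat n x) (p_hat n x - G (p_hat n x))"
  shows "beta_L1 G n x = 0"
proof -
  let ?g = "\<lambda>j. g_loo G n x j j" and ?h = "\<lambda>j. G (p_hat n x) j" and ?N = "real n"
  have N: "?N > 1" using x(2) by simp
  have summand: "?N\<^sup>2 * (p_hat n x j * (p_hat n x j - ?h j)) - real (x j)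
      \<le> (real (x j) - ?N * ?g j)\<^sup>2 + (?N + 1) * ?g j * (real (x j) - ?N * ?g j) + ?N * (?g j)\<^sup>2" for j
  proof -
    have "(?N - 1) * (real (x j) * ?g j) \<le> ?N * (real (x j) * ?h j) + real (x j)"
    proof (cases "x j = 0")
      case False
      then have "?g j \<le> ?h j + 1 / (?N - 1)"
        using g_loo_close[OF x, of j j] by auto
      then have "(?N - 1) * ?g j \<le> (?N - 1) * ?h j + 1"
        using N by (simp add: field_simps)
      also have "\<dots> \<le> ?N * ?h j + 1"
        using prob_vecs_nonneg[OF maps[OF freq_data_p_hat[OF x(1)]]] x(2)
        by (simp add: algebra_simps)
      finally have "real (x j) * ((?N - 1) * ?g j) \<le> real (x j) * (?N * ?h j + 1)"
        by (rule mult_left_mono) simp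
      then show ?thesis by (simp add: algebra_simps)
    qed simp
    moreover have "?N\<^sup>2 * (p_hat n x j * (p_hat n x j - ?h j)) = (real (x j))\<^sup>2 - ?N * (real (x j) * ?h j)"
      using N by (simp add: p_hat_def field_simps power2_eq_square)
    ultimately show ?thesis by (simp add: power2_eq_square algebra_simps)
  qed
  have "linner (p_hat n x) (p_hat n x - G (p_hat n x))
      = (\<Sum>j = 0..t_max x. p_hat n x j * (p_hat n x j - ?h j))"
    unfolding linner_def
    using freq_data_sum_t_max[OF x(1), of "\<lambda>j. p_hat n x j * (p_hat n x j - ?h j)"]
    by (simp add: p_hat_def sums_iff)
  then have "?N\<^sup>2 * linner (p_hat n x) (p_hat n x - G (p_hat n x)) - ?N
      = (\<Sum>j = 0..t_max x. ?N\<^sup>2 * (p_hat n x j * (p_hat n x j - ?h j)) - real (x j))"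
    by (simp add: sum_subtractf freq_data_sum[OF x(1)] sum_distrib_left)
  also have "\<dots> \<le> (\<Sum>j = 0..t_max x. (real (x j) - ?N * ?g j)\<^sup>2
      + (?N + 1) * ?g j * (real (x j) - ?N * ?g j) + ?N * (?g j)\<^sup>2)"
    by (rule sum_mono) (rule summand)
  finally have *: "?N\<^sup>2 * linner (p_hat n x) (p_hat n x - G (p_hat n x)) - ?N \<le> \<dots>" .
  \<comment> \<open>From \<open>n * D \<ge> 2\<close> follows
    \<open>n\<^sup>2 * D - n \<ge> n\<close>, the threshold at which the weight becomes 0.\<close>
  have "?N * 2 \<le> ?N * (?N * linner (p_hat n x) (p_hat n x - G (p_hat n x)))"
    by (rule mult_left_mono[OF large]) simp
  with * show ?thesis by (simp add: beta_L1_def power2_eq_square algebra_simps)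
qed

text \<open>Both leave-one-out values at cell \<open>k\<close> are within \<open>1 / (n - 1)\<close>
  of \<open>G (p_hat n x) k\<close>, so their difference is at most \<open>2 / (n - 1)\<close>. The
  factor \<open>n - 1\<close> cancels and the double sum contributes at most
  \<open>2 * n\<^sup>2\<close>, on top of the leading \<open>n\<^sup>2\<close>.\<close>

lemma b_L2_le:
  assumes x: "freq_data n x" "2 \<le> n"
  shows "b_L2 G n x \<le> 3 * (real n)\<^sup>2"
proof -
  let ?g = "\<lambda>j k. g_loo G n x j k" and ?N = "real n"
  have N: "?N > 1" using x(2) by simp
  \<comment> \<open>In an unobserved cell \<open>g_loo\<close> has only its default value 0, but
    there the factor \<open>x j\<close> or \<open>x k\<close> vanishes.\<close>
  have diff: "real (x j) * (real (x k) * (?g k k - ?g j k)) \<le> real (x j) * (real (x k) * (2 / (?N - 1)))" for j k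
  proof (cases "x j = 0 \<or> x k = 0")
    case False
    then have "?g k k - ?g j k \<le> 2 / (?N - 1)"
      using g_loo_close[OF x, of j k] g_loo_close[OF x, of k k] by auto
    then show ?thesis by (intro mult_left_mono) auto
  qed auto
  have "(\<Sum>j = 0..t_max x. real (x j) * (\<Sum>k = 0..t_max x. real (x k) * (?g k k - ?g j k)))
      \<le> (\<Sum>j = 0..t_max x. real (x j) * (\<Sum>k = 0..t_max x. real (x k) * (2 / (?N - 1))))"
    unfolding sum_distrib_left by (intro sum_mono diff)
  also have "\<dots> = ?N * (?N * (2 / (?N - 1)))"
    by (simp only: sum_distrib_right[symmetric] freq_data_sum[OF x(1)])
  finally have "(?N - 1) * (\<Sum>j = 0..t_max x. real (x j) * (\<Sum>k = 0..t_max x. real (x k) * (?g k k - ?g j k)))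
      \<le> (?N - 1) * (?N * (?N * (2 / (?N - 1))))"
    using N by (intro mult_left_mono) auto
  also have "\<dots> = 2 * ?N\<^sup>2" using N by (simp add: power2_eq_square)
  finally have "(?N - 1) * (\<Sum>j = 0..t_max x. real (x j) * (\<Sum>k = 0..t_max x. real (x k) * (?g k k - ?g j k)))
      \<le> 2 * ?N\<^sup>2" .
  moreover have "0 \<le> (\<Sum>j = 0..t_max x. (real (x j))\<^sup>2)" by (simp add: sum_nonneg)
  ultimately show ?thesis by (simp add: b_L2_def)
qed

text \<open>A single cell \<open>k\<close> where \<open>p_hat\<close> exceeds its image by
  \<open>e\<close> makes every inner sum of squares at least \<open>(n * e)\<^sup>2 / 4\<close>.
  Weighted by the counts, this gives \<open>n ^ 3 * e\<^sup>2 / 4\<close>, while the linear terms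
  cost at most \<open>2 * n\<^sup>2\<close>. The last hypothesis makes that cost at most half of the
  gain.\<close>

lemma a_L2_ge:
  assumes x: "freq_data n x" "2 \<le> n" and k: "x k > 0"
    and e: "0 < e" "e \<le> p_hat n x k - G (p_hat n x) k" "2 \<le> real n * e" "16 \<le> real n * e\<^sup>2"
  shows "(real n)^3 * e\<^sup>2 / 8 \<le> a_L2 G n x"
proof -
  let ?g = "\<lambda>j k. g_loo G n x j k" and ?N = "real n" and ?h = "G (p_hat n x)"
  have N: "?N > 1" using x(2) by simp
  have inner: "(?N * e)\<^sup>2 / 4 \<le> (\<Sum>k = 0..t_max x. (real (x k) - (?N - 1) * ?g j k)\<^sup>2)" if "x j > 0" for j
  proof -
    have "?g j k \<le> ?h k + 1 / (?N - 1)"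
      using g_loo_close[OF x that, of k] by auto
    then have "(?N - 1) * ?g j k \<le> (?N - 1) * ?h k + 1"
      using N by (simp add: field_simps)
    also have "\<dots> \<le> ?N * ?h k + 1"
      using prob_vecs_nonneg[OF maps[OF freq_data_p_hat[OF x(1)]]] x(2)
      by (simp add: algebra_simps)
    finally have "(?N - 1) * ?g j k \<le> ?N * ?h k + 1" .
    moreover have "?N * p_hat n x k = real (x k)" using N by (simp add: p_hat_def)
    ultimately have "?N * (p_hat n x k - ?h k) - 1 \<le> real (x k) - (?N - 1) * ?g j k"
      by (simp add: right_diff_distrib)
    moreover have "?N * e \<le> ?N * (p_hat n x k - ?h k)"
      by (rule mult_left_mono[OF e(2)]) simp
    \<comment> \<open>The residual at \<open>k\<close> is at least \<open>n * e - 1\<close>, and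
      \<open>n * e \<ge> 2\<close> absorbs the 1.\<close>
    ultimately have "?N * e / 2 \<le> real (x k) - (?N - 1) * ?g j k"
      using e(3) by linarith
    then have "(?N * e / 2)\<^sup>2 \<le> (real (x k) - (?N - 1) * ?g j k)\<^sup>2"
      using e(1) by (intro power_mono) auto
    \<comment> \<open>Only the term of the observed cell \<open>k\<close> is kept, which lies in the
      range of summation.\<close>
    also have "\<dots> \<le> (\<Sum>k = 0..t_max x. (real (x k) - (?N - 1) * ?g j k)\<^sup>2)"
      by (rule member_le_sum) (use freq_data_le_t_max[OF x(1) k] in auto)
    finally show ?thesis by (simp add: power_divide)
  qed
  have "real (x j) * (2 * (real (x j) - ?g j j * (?N - 1))
        - (\<Sum>k = 0..t_max x. (real (x k) - (?N - 1) * ?g j k)\<^sup>2))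
      \<le> real (x j) * (2 * ?N - (?N * e)\<^sup>2 / 4)" for j
  proof (cases "x j = 0")
    case False
    then have xj: "x j > 0" by simp
    then have "0 \<le> ?g j j"
      using x prob_vecs_nonneg[OF maps[OF freq_data_p_loo[OF x xj]]] by (simp add: g_loo_def)
    then have "0 \<le> ?g j j * (?N - 1)" using N by simp
    moreover have "real (x j) \<le> ?N" using freq_data_le[OF x(1)] by simp
    ultimately have "2 * (real (x j) - ?g j j * (?N - 1)) \<le> 2 * ?N" by simp
    from diff_mono[OF this inner[OF xj]] show ?thesis
      by (rule mult_left_mono) simp
  qed simp
  then have "(\<Sum>j = 0..t_max x. real (x j) * (2 * (real (x j) - ?g j j * (?N - 1))
        - (\<Sum>k = 0..t_max x. (real (x k) - (?N - 1) * ?g j k)\<^sup>2)))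
      \<le> (\<Sum>j = 0..t_max x. real (x j) * (2 * ?N - (?N * e)\<^sup>2 / 4))"
    by (rule sum_mono)
  also have "\<dots> = ?N * (2 * ?N - (?N * e)\<^sup>2 / 4)"
    by (simp only: sum_distrib_right[symmetric] freq_data_sum[OF x(1)])
  finally have "?N + ?N * ((?N * e)\<^sup>2 / 4 - 2 * ?N) \<le> a_L2 G n x"
    by (simp add: a_L2_def algebra_simps)
  moreover have "?N * ((?N * e)\<^sup>2 / 4 - 2 * ?N) = ?N^3 * e\<^sup>2 / 4 - 2 * ?N\<^sup>2"
    by (simp add: power2_eq_square power3_eq_cube algebra_simps)
  moreover have "?N\<^sup>2 * 16 \<le> ?N\<^sup>2 * (?N * e\<^sup>2)"
    by (rule mult_left_mono[OF e(4)]) simp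
  then have "?N\<^sup>2 * 16 \<le> ?N^3 * e\<^sup>2"
    by (simp only: power2_eq_square power3_eq_cube mult.assoc)
  ultimately show ?thesis using N by linarith
qed

text \<open>The constant 24 comes from the numerator bound \<open>3 * n\<^sup>2\<close> divided by
  the denominator bound \<open>n ^ 3 * e\<^sup>2 / 8\<close>.\<close>

lemma beta_L2_le:
  assumes x: "freq_data n x" "2 \<le> n" and k: "x k > 0"
    and e: "0 < e" "e \<le> p_hat n x k - G (p_hat n x) k" "2 \<le> real n * e" "16 \<le> real n * e\<^sup>2"
  shows "beta_L2 G n x \<le> 24 / (real n * e\<^sup>2)"
proof -
  let ?a = "a_L2 G n x" and ?b = "b_L2 G n x" and ?N = "real n"
  define L where "L = ?N^3 * e\<^sup>2 / 8"
  have L: "L > 0" "L \<le> ?a" using a_L2_ge[OF assms] x(2) e(1) by (auto simp: L_def)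
  have b: "?b \<le> 3 * ?N\<^sup>2" by (rule b_L2_le[OF x])
  have r: "3 * ?N\<^sup>2 / L = 24 / (?N * e\<^sup>2)"
    using x(2) e(1) by (simp add: L_def field_simps power2_eq_square power3_eq_cube)
  consider "?b < 0" | "0 \<le> ?b" "?b \<le> ?a" | "?a < ?b" "0 \<le> ?b" by linarith
  then show ?thesis
  proof cases
    case 1
    then show ?thesis using x e by (simp add: beta_L2_def)
  next
    case 2
    then have "beta_L2 G n x = ?b / ?a" using L by (simp add: beta_L2_def)
    also have "\<dots> \<le> 3 * ?N\<^sup>2 / L" using 2 L b by (intro frac_le) auto
    finally show ?thesis by (simp add: r)
  next
    case 3
    \<comment> \<open>Here the weight is clipped to 1; but
      \<open>L \<le> ?a < ?b \<le> 3 * ?N\<^sup>2\<close> shows that the claimed bound is itself at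
      least 1.\<close>
    then have "1 \<le> 3 * ?N\<^sup>2 / L" using L b by (simp add: le_divide_eq)
    moreover have "beta_L2 G n x \<le> 1" using 3 L by (simp add: beta_L2_def)
    ultimately show ?thesis by (simp add: r)
  qed
qed

text \<open>Each term splits into \<open>(f j - h j) * (f j - G f j)\<close>, where the second
  factor lies between -1 and 1, and \<open>h j\<close> times a difference of residuals, which is at
  most \<open>2 * \<delta>\<close> by the contraction. Summation gives
  \<open>\<delta> + 2 * \<delta>\<close>, because \<open>h\<close> sums to 1.\<close>

lemma linner_residual_diff_le:
  assumes f: "f \<in> prob_vecs" and h: "h \<in> prob_vecs"
  shows "\<bar>linner f (f - G f) - linner h (h - G h)\<bar> \<le> 3 * lnorm 1 (\<lambda>j. f j - h j)"
proof -
  define \<delta> where "\<delta> = lnorm 1 (\<lambda>j. f j - h j)"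
  have s: "summable (\<lambda>j. u j * (u j - G u j))" if "u \<in> prob_vecs" for u
  proof (rule summable_comparison_test'[OF prob_vecs_summable[OF that], of 0])
    show "norm (u j * (u j - G u j)) \<le> u j" for j
      using prob_vecs_nonneg[OF that, of j] prob_vecs_le_one[OF that, of j]
        prob_vecs_nonneg[OF maps[OF that], of j] prob_vecs_le_one[OF maps[OF that], of j]
      by (auto simp: abs_mult intro!: mult_left_le)
  qed
  have summand: "\<bar>f j * (f j - G f j) - h j * (h j - G h j)\<bar> \<le> \<bar>f j - h j\<bar> + h j * (2 * \<delta>)" for j
  proof -
    have "\<bar>f j - G f j\<bar> \<le> 1"
      using prob_vecs_nonneg[OF f, of j] prob_vecs_le_one[OF f, of j]
        prob_vecs_nonneg[OF maps[OF f], of j] prob_vecs_le_one[OF maps[OF f], of j]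
      by auto
    then have 1: "\<bar>(f j - h j) * (f j - G f j)\<bar> \<le> \<bar>f j - h j\<bar>"
      by (simp add: abs_mult mult_left_le)
    have "\<bar>f j - h j\<bar> \<le> \<delta>"
      using abs_le_lnorm[OF prob_vecs_diff_summable[OF f h] order_refl, of j] by (simp add: \<delta>_def)
    moreover have "\<bar>G f j - G h j\<bar> \<le> \<delta>"
      unfolding \<delta>_def by (rule contraction_lnorm_one[OF f h])
    ultimately have "\<bar>(f j - h j) - (G f j - G h j)\<bar> \<le> 2 * \<delta>" by linarith
    then have 2: "\<bar>h j * ((f j - h j) - (G f j - G h j))\<bar> \<le> h j * (2 * \<delta>)"
      using prob_vecs_nonneg[OF h, of j] by (simp add: abs_mult mult_left_mono)
    have "f j * (f j - G f j) - h j * (h j - G h j)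
        = (f j - h j) * (f j - G f j) + h j * ((f j - h j) - (G f j - G h j))"
      by (simp add: algebra_simps)
    with 1 2 show ?thesis by linarith
  qed
  have bound: "(\<lambda>j. \<bar>f j - h j\<bar> + h j * (2 * \<delta>)) sums (\<delta> + 1 * (2 * \<delta>))"
    unfolding \<delta>_def lnorm_one
    by (intro sums_add sums_mult2 prob_vecs_sums h summable_sums prob_vecs_diff_summable f)
  have "\<bar>linner f (f - G f) - linner h (h - G h)\<bar>
      = norm (\<Sum>j. f j * (f j - G f j) - h j * (h j - G h j))"
    by (simp add: linner_def suminf_diff[OF s[OF f] s[OF h]])
  also have "\<dots> \<le> (\<Sum>j. \<bar>f j - h j\<bar> + h j * (2 * \<delta>))"
    by (rule norm_suminf_le[OF _ sums_summable[OF bound]]) (use summand in simp)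
  also have "\<dots> = 3 * \<delta>" using sums_unique[OF bound] by simp
  finally show ?thesis by (simp add: \<delta>_def)
qed

text \<open>The inner product of \<open>beta_L1_eq_0\<close> converges to a positive limit, so
  \<open>n\<close> times it eventually exceeds 2.\<close>

lemma beta_L1_eventually_0:
  assumes p: "p \<in> prob_vecs" and x: "\<And>n. freq_data n (x n)"
    and lim: "(\<lambda>n. lnorm 1 (\<lambda>j. p_hat n (x n) j - p j)) \<longlonglongrightarrow> 0"
    and pos: "0 < linner p (p - G p)"
  shows "eventually (\<lambda>n. beta_L1 G n (x n) = 0) sequentially"
proof -
  let ?D = "\<lambda>n. linner (p_hat n (x n)) (p_hat n (x n) - G (p_hat n (x n)))"
  have "(\<lambda>n. ?D n - linner p (p - G p)) \<longlonglongrightarrow> 0"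
  proof (rule Lim_null_comparison[OF _ tendsto_mult_right_zero[OF lim]])
    show "eventually (\<lambda>n. norm (?D n - linner p (p - G p))
        \<le> 3 * lnorm 1 (\<lambda>j. p_hat n (x n) j - p j)) sequentially"
      using eventually_ge_at_top[of 1]
    proof eventually_elim
      case (elim n)
      from linner_residual_diff_le[OF freq_data_p_hat[OF x elim] p] show ?case by simp
    qed
  qed
  then have "?D \<longlonglongrightarrow> linner p (p - G p)" by (rule LIM_zero_cancel)
  from filterlim_tendsto_pos_mult_at_top[OF this pos filterlim_real_sequentially]
  have "eventually (\<lambda>n. 2 \<le> ?D n * real n) sequentially"
    by (simp add: filterlim_at_top)
  with eventually_ge_at_top[of 2] show ?thesis
  proof eventually_elim
    case (elim n)
    show ?case by (rule beta_L1_eq_0[OF x elim(1)]) (use elim(2) in \<open>simp add: mult.commute\<close>)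
  qed
qed

text \<open>At one fixed cell the gap between \<open>p_hat\<close> and its image stays above a
  constant \<open>e\<close>, so \<open>beta_L2_le\<close> bounds the weight by a multiple of
  \<open>1 / n\<close>.\<close>

lemma sqrt_beta_L2_tendsto_0:
  assumes p: "p \<in> prob_vecs" and x: "\<And>n. freq_data n (x n)"
    and lim: "(\<lambda>n. lnorm 1 (\<lambda>j. p_hat n (x n) j - p j)) \<longlonglongrightarrow> 0"
    and coord: "\<And>j. (\<lambda>n. p_hat n (x n) j) \<longlonglongrightarrow> p j"
    and "G p \<noteq> p"
  shows "(\<lambda>n. sqrt (real n) * beta_L2 G n (x n)) \<longlonglongrightarrow> 0"
proof -
  text \<open>Both vectors sum to \<open>1\<close>, so somewhere \<open>p\<close> exceeds \<open>G p\<close>; such a coordinate lies in the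
    support of \<open>p\<close>, hence is eventually observed.\<close>
  obtain k where k: "G p k < p k"
  proof (rule ccontr)
    assume "\<not> thesis"
    with that have le: "p j \<le> G p j" for j by (metis not_le)
    obtain i where "G p i \<noteq> p i" using \<open>G p \<noteq> p\<close> by auto
    then have "0 < (\<Sum>j. G p j - p j)"
      using le by (intro suminf_pos2[of _ i] summable_diff prob_vecs_summable maps p)
        (auto simp: less_le)
    also have "\<dots> = 0"
      using p by (simp add: suminf_diff[symmetric] prob_vecs_summable prob_vecs_suminf maps)
    finally show False by simp
  qed
  \<comment> \<open>Half of the limiting gap, so that the empirical gap eventually exceeds
    \<open>e\<close>.\<close>
  define e where "e = (p k - G p k) / 2"
  have e: "0 < e" using k by (simp add: e_def)
  have "(\<lambda>n. G (p_hat n (x n)) k) \<longlonglongrightarrow> G p k"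
    by (rule G_tendsto[OF _ p lim, of 1]) (use freq_data_p_hat x in auto)
  from tendsto_diff[OF coord this]
  have "(\<lambda>n. p_hat n (x n) k - G (p_hat n (x n)) k) \<longlonglongrightarrow> p k - G p k" .
  moreover have "e < p k - G p k" using e by (simp add: e_def)
  ultimately have "eventually (\<lambda>n. e < p_hat n (x n) k - G (p_hat n (x n)) k) sequentially"
    by (rule order_tendstoD(1))
  moreover have "0 < p k"
    using k prob_vecs_nonneg[OF maps[OF p], of k] by simp
  then have "eventually (\<lambda>n. 0 < p_hat n (x n) k) sequentially"
    by (rule order_tendstoD(1)[OF coord])
  moreover have "eventually (\<lambda>n. 2 \<le> real n * e) sequentially"
    "eventually (\<lambda>n. 16 \<le> real n * e\<^sup>2) sequentially"
    using e by real_asymp+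
  ultimately have "eventually (\<lambda>n. norm (sqrt (real n) * beta_L2 G n (x n))
      \<le> sqrt (real n) * (24 / (real n * e\<^sup>2))) sequentially"
    using eventually_ge_at_top[of 2]
  proof eventually_elim
    case (elim n)
    have xk: "0 < x n k" using elim(2) by (cases "x n k") (auto simp: p_hat_def)
    have "beta_L2 G n (x n) \<le> 24 / (real n * e\<^sup>2)"
      by (rule beta_L2_le[OF x elim(5) xk e]) (use elim in auto)
    then have "sqrt (real n) * beta_L2 G n (x n) \<le> sqrt (real n) * (24 / (real n * e\<^sup>2))"
      by (rule mult_left_mono) simp
    then show ?case
      using beta_bounds(1)[of L2 G n "x n"] by (simp add: abs_mult)
  qed
  moreover have "(\<lambda>n. sqrt (real n) * (24 / (real n * e\<^sup>2))) \<longlonglongrightarrow> 0"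
    using e by real_asymp
  ultimately show ?thesis by (rule Lim_null_comparison)
qed

lemma sqrt_beta_tendsto_0:
  assumes p: "p \<in> prob_vecs" and x: "\<And>n. freq_data n (x n)"
    and coord: "\<And>j. (\<lambda>n. p_hat n (x n) j) \<longlonglongrightarrow> p j"
    and ne: "G p \<noteq> p" and orth: "linner (G p) (p - G p) = 0"
  shows "(\<lambda>n. sqrt (real n) * beta d G n (x n)) \<longlonglongrightarrow> 0"
proof -
  \<comment> \<open>Scheffe's lemma upgrades cellwise convergence to convergence in l_1.\<close>
  have lim: "(\<lambda>n. lnorm 1 (\<lambda>j. p_hat n (x n) j - p j)) \<longlonglongrightarrow> 0"
    by (rule prob_vecs_tendsto_lnorm_one[OF freq_data_p_hat[OF x] p coord])
  show ?thesis
  proof (cases d)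
    case L1
    have "0 < linner p (p - G p)" by (rule linner_diff_pos[OF p maps[OF p] ne orth])
    from beta_L1_eventually_0[OF p x lim this] show ?thesis
      by (intro tendsto_eventually) (auto elim: eventually_mono simp: L1)
  next
    case L2
    with sqrt_beta_L2_tendsto_0[OF p x lim coord ne] show ?thesis by simp
  qed
qed

section \<open>Error of the convex combination\<close>

lemma stacked_prob_vecs:
  assumes "freq_data n x" "1 \<le> n"
  shows "stacked d G n x \<in> prob_vecs"
  unfolding stacked_def[abs_def]
  by (intro prob_vecs_convex maps freq_data_p_hat assms beta_bounds)

text \<open>The first bound serves the case \<open>G p = p\<close>, where both components are close
  to \<open>p\<close>. The second serves \<open>G p \<noteq> p\<close>: the estimator is
  \<open>p_hat\<close> plus the weight times a difference of probability vectors, whose norm is at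
  most 2.\<close>

lemma lnorm_stacked_le:
  assumes x: "freq_data n x" "1 \<le> n" and p: "p \<in> prob_vecs" and l: "l = 1 \<or> l = 2"
  shows "lnorm l (stacked d G n x - p) \<le> lnorm l (p_hat n x - p) + lnorm l (G (p_hat n x) - p)"
    and "lnorm l (stacked d G n x - p) \<le> lnorm l (p_hat n x - p) + 2 * beta d G n x"
proof -
  let ?b = "beta d G n x" and ?u = "p_hat n x" and ?v = "G (p_hat n x)"
  have u: "?u \<in> prob_vecs" and v: "?v \<in> prob_vecs"
    using freq_data_p_hat[OF x] maps by auto
  note b = beta_bounds[of d G n x]
  note sums = prob_vecs_diff_summable[OF u p] prob_vecs_diff_summable[OF v p] prob_vecs_diff_summable[OF v u]
  have smult: "summable (\<lambda>j. \<bar>c * h j\<bar>)" if "summable (\<lambda>j. \<bar>h j\<bar>)" for c and h :: "nat \<Rightarrow> real"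
    using that by (simp add: abs_mult summable_mult)
  have l1: "1 \<le> l" using l by auto
  have "lnorm l (stacked d G n x - p) = lnorm l (\<lambda>j. (1 - ?b) * (?u j - p j) + ?b * (?v j - p j))"
    by (rule arg_cong[where f = "lnorm l"]) (auto simp: stacked_def algebra_simps)
  also have "\<dots> \<le> (1 - ?b) * lnorm l (\<lambda>j. ?u j - p j) + ?b * lnorm l (\<lambda>j. ?v j - p j)"
    using lnorm_triangle[OF l smult[OF sums(1)] smult[OF sums(2)], of "1 - ?b" ?b] b
    by (simp add: lnorm_mult[OF l] sums)
  also have "\<dots> \<le> lnorm l (\<lambda>j. ?u j - p j) + lnorm l (\<lambda>j. ?v j - p j)"
    using b lnorm_nonneg[OF sums(1) l1] lnorm_nonneg[OF sums(2) l1]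
    by (intro add_mono mult_left_le_one_le) auto
  finally show "lnorm l (stacked d G n x - p) \<le> lnorm l (?u - p) + lnorm l (?v - p)"
    by (simp add: fun_diff_def)
  have "lnorm l (stacked d G n x - p) = lnorm l (\<lambda>j. (?u j - p j) + ?b * (?v j - ?u j))"
    by (rule arg_cong[where f = "lnorm l"]) (auto simp: stacked_def algebra_simps)
  also have "\<dots> \<le> lnorm l (\<lambda>j. ?u j - p j) + ?b * lnorm l (\<lambda>j. ?v j - ?u j)"
    using lnorm_triangle[OF l sums(1) smult[OF sums(3)], of ?b] b
    by (simp add: lnorm_mult[OF l] sums)
  also have "\<dots> \<le> lnorm l (\<lambda>j. ?u j - p j) + ?b * 2"
    using lnorm_antimono[OF sums(3) order_refl l1] lnorm_one_prob_vecs_diff_le[OF v u] b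
    by (intro add_left_mono mult_left_mono) auto
  finally show "lnorm l (stacked d G n x - p) \<le> lnorm l (?u - p) + 2 * ?b"
    by (simp add: fun_diff_def mult.commute)
qed

end

section \<open>The empirical distribution\<close>

context prob_space
begin

text \<open>Independence and centring remove the cross terms of the expanded square; boundedness
  makes all products integrable.\<close>

lemma expectation_sum_squared_le:
  fixes X :: "'i \<Rightarrow> 'a \<Rightarrow> real"
  assumes I: "finite I" and ind: "indep_vars (\<lambda>_. borel) X I"
    and bdd: "\<And>i \<omega>. i \<in> I \<Longrightarrow> \<bar>X i \<omega>\<bar> \<le> B"
    and mean: "\<And>i. i \<in> I \<Longrightarrow> expectation (X i) = 0"
    and var: "\<And>i. i \<in> I \<Longrightarrow> expectation (\<lambda>\<omega>. (X i \<omega>)\<^sup>2) \<le> v"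
  shows "expectation (\<lambda>\<omega>. (\<Sum>i\<in>I. X i \<omega>)\<^sup>2) \<le> real (card I) * v"
proof -
  have rv [measurable]: "random_variable borel (X i)" if "i \<in> I" for i
    using ind that by (auto simp: indep_vars_def)
  have int1: "integrable M (X i)" if "i \<in> I" for i
    using bdd[OF that] rv[OF that] by (intro integrable_const_bound[of _ B]) auto
  have int2: "integrable M (\<lambda>\<omega>. X i \<omega> * X k \<omega>)" if "i \<in> I" "k \<in> I" for i k
  proof (rule integrable_const_bound[of _ "B * B"])
    have "\<bar>X i \<omega> * X k \<omega>\<bar> \<le> B * B" for \<omega>
      unfolding abs_mult using bdd that
      by (intro mult_mono) (auto intro: order_trans[OF abs_ge_zero])
    then show "AE \<omega> in M. norm (X i \<omega> * X k \<omega>) \<le> B * B" by simp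
    show "(\<lambda>\<omega>. X i \<omega> * X k \<omega>) \<in> borel_measurable M"
      using rv that by measurable
  qed
  have cross: "expectation (\<lambda>\<omega>. X i \<omega> * X k \<omega>) = 0" if "i \<in> I" "k \<in> I" "i \<noteq> k" for i k
  proof -
    have "expectation (\<lambda>\<omega>. \<Prod>l\<in>{i, k}. X l \<omega>) = (\<Prod>l\<in>{i, k}. expectation (X l))"
      using that by (intro indep_vars_lebesgue_integral indep_vars_subset[OF ind] int1) auto
    with that show ?thesis by (simp add: mean)
  qed
  have "expectation (\<lambda>\<omega>. (\<Sum>i\<in>I. X i \<omega>)\<^sup>2) = expectation (\<lambda>\<omega>. \<Sum>i\<in>I. \<Sum>k\<in>I. X i \<omega> * X k \<omega>)"
    by (simp add: power2_eq_square sum_product)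
  also have "\<dots> = (\<Sum>i\<in>I. \<Sum>k\<in>I. expectation (\<lambda>\<omega>. X i \<omega> * X k \<omega>))"
    by (simp add: int2)
  also have "\<dots> = (\<Sum>i\<in>I. \<Sum>k\<in>I. if k = i then expectation (\<lambda>\<omega>. (X i \<omega>)\<^sup>2) else 0)"
    by (intro sum.cong refl) (auto simp: cross power2_eq_square)
  also have "\<dots> = (\<Sum>i\<in>I. expectation (\<lambda>\<omega>. (X i \<omega>)\<^sup>2))"
    using I by simp
  also have "\<dots> \<le> real (card I) * v"
    by (rule sum_bounded_above[OF var])
  finally show ?thesis .
qed

text \<open>Rates are stated at order 0, with the factor \<open>sqrt n\<close> inside the sequence.
  Dropping the power of \<open>n\<close> is sound since \<open>n > N\<close> excludes
  \<open>n = 0\<close>, where \<open>0 powr 0 = 0\<close>.\<close>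

lemma bigOp_0_iff:
  "bigOp M b 0 \<longleftrightarrow> (\<forall>\<epsilon>>0. \<exists>K>0. \<exists>N>0. \<forall>n>N. prob {\<omega> \<in> space M. \<bar>b n \<omega>\<bar> > K} < \<epsilon>)"
proof -
  have eq: "prob {\<omega> \<in> space M. K < real n powr (- 0) * \<bar>b n \<omega>\<bar>} = prob {\<omega> \<in> space M. K < \<bar>b n \<omega>\<bar>}"
    if "0 < n" for n K
    using that by simp
  have "(\<forall>n>N. prob {\<omega> \<in> space M. K < real n powr (- 0) * \<bar>b n \<omega>\<bar>} < \<epsilon>)
      \<longleftrightarrow> (\<forall>n>N. prob {\<omega> \<in> space M. K < \<bar>b n \<omega>\<bar>} < \<epsilon>)" for N K \<epsilon>
  proof (intro iff_allI imp_cong refl)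
    fix n assume "N < n"
    then have "0 < n" by simp
    then show "prob {\<omega> \<in> space M. K < real n powr (- 0) * \<bar>b n \<omega>\<bar>} < \<epsilon>
        \<longleftrightarrow> prob {\<omega> \<in> space M. K < \<bar>b n \<omega>\<bar>} < \<epsilon>"
      by (simp only: eq)
  qed
  then show ?thesis unfolding bigOp_def by (simp only:)
qed

text \<open>If \<open>\<bar>C\<bar>\<close> exceeds \<open>K1 + K2\<close>, then
  \<open>\<bar>A\<bar>\<close> exceeds \<open>K1\<close> or \<open>\<bar>B\<bar>\<close> exceeds
  \<open>K2\<close>; a union bound with \<open>\<epsilon> / 2\<close> each concludes.\<close>

lemma bigOp_0_le_add:
  assumes A: "bigOp M A 0" and B: "bigOp M B 0"
    and meas: "\<And>n. A n \<in> borel_measurable M" "\<And>n. B n \<in> borel_measurable M"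
    and le: "\<And>n \<omega>. n > n0 \<Longrightarrow> \<omega> \<in> space M \<Longrightarrow> \<bar>C n \<omega>\<bar> \<le> \<bar>A n \<omega>\<bar> + \<bar>B n \<omega>\<bar>"
  shows "bigOp M C 0"
  unfolding bigOp_0_iff
proof (intro allI impI)
  fix \<epsilon> :: real assume "\<epsilon> > 0"
  then have "\<epsilon> / 2 > 0" by simp
  from A[unfolded bigOp_0_iff, rule_format, OF this] obtain K1 N1 where
    1: "K1 > 0" "N1 > 0" "\<And>n. n > N1 \<Longrightarrow> prob {\<omega> \<in> space M. \<bar>A n \<omega>\<bar> > K1} < \<epsilon> / 2"
    by blast
  from B[unfolded bigOp_0_iff, rule_format, OF \<open>\<epsilon> / 2 > 0\<close>] obtain K2 N2 where
    2: "K2 > 0" "N2 > 0" "\<And>n. n > N2 \<Longrightarrow> prob {\<omega> \<in> space M. \<bar>B n \<omega>\<bar> > K2} < \<epsilon> / 2"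
    by blast
  note meas [measurable]
  have "prob {\<omega> \<in> space M. \<bar>C n \<omega>\<bar> > K1 + K2} < \<epsilon>" if n: "n > n0 + N1 + N2" for n
  proof -
    have "prob {\<omega> \<in> space M. \<bar>C n \<omega>\<bar> > K1 + K2}
        \<le> prob ({\<omega> \<in> space M. \<bar>A n \<omega>\<bar> > K1} \<union> {\<omega> \<in> space M. \<bar>B n \<omega>\<bar> > K2})"
    proof (rule finite_measure_mono)
      have "\<bar>A n \<omega>\<bar> > K1 \<or> \<bar>B n \<omega>\<bar> > K2"
        if "\<omega> \<in> space M" "\<bar>C n \<omega>\<bar> > K1 + K2" for \<omega>
        using le[of n \<omega>] n that by auto
      then show "{\<omega> \<in> space M. \<bar>C n \<omega>\<bar> > K1 + K2}
          \<subseteq> {\<omega> \<in> space M. \<bar>A n \<omega>\<bar> > K1} \<union> {\<omega> \<in> space M. \<bar>B n \<omega>\<bar> > K2}" by auto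
    qed measurable
    also have "\<dots> \<le> prob {\<omega> \<in> space M. \<bar>A n \<omega>\<bar> > K1} + prob {\<omega> \<in> space M. \<bar>B n \<omega>\<bar> > K2}"
      by (intro measure_Un_le) measurable
    also have "\<dots> < \<epsilon>" using 1(3)[of n] 2(3)[of n] n by simp
    finally show ?thesis .
  qed
  then show "\<exists>K>0. \<exists>N>0. \<forall>n>N. prob {\<omega> \<in> space M. \<bar>C n \<omega>\<bar> > K} < \<epsilon>"
    using 1(1,2) 2(1,2) by (intro exI[of _ "K1 + K2"] exI[of _ "n0 + N1 + N2"] conjI) auto
qed

lemma bigOp_0_const: "bigOp M (\<lambda>_ _. c) 0"
  unfolding bigOp_0_iff
  by (intro allI impI exI[of _ "\<bar>c\<bar> + 1"] conjI exI[of _ 1]) auto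

text \<open>Dominated convergence of indicators gives convergence in probability, so the bound 1
  serves for every \<open>\<epsilon>\<close>.\<close>

lemma AE_tendsto_0_imp_bigOp_0:
  assumes [measurable]: "\<And>n. X n \<in> borel_measurable M"
    and lim: "AE \<omega> in M. (\<lambda>n. X n \<omega>) \<longlonglongrightarrow> 0"
  shows "bigOp M X 0"
  unfolding bigOp_0_iff
proof (intro allI impI)
  fix \<epsilon> :: real assume "\<epsilon> > 0"
  let ?A = "\<lambda>n. {\<omega> \<in> space M. \<bar>X n \<omega>\<bar> > 1}"
  have "(\<lambda>n. expectation (indicator (?A n) :: 'a \<Rightarrow> real)) \<longlonglongrightarrow> expectation (\<lambda>_. 0 :: real)"
  proof (rule integral_dominated_convergence[where w = "\<lambda>_. 1"])
    show "AE \<omega> in M. (\<lambda>n. indicator (?A n) \<omega> :: real) \<longlonglongrightarrow> 0"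
      using lim
    proof eventually_elim
      case (elim \<omega>)
      from tendstoD[OF elim, of 1] have "eventually (\<lambda>n. \<bar>X n \<omega>\<bar> < 1) sequentially" by simp
      then show ?case
        by (intro tendsto_eventually) (auto elim!: eventually_mono simp: indicator_def)
    qed
  qed (auto simp: indicator_def)
  then have "(\<lambda>n. prob (?A n)) \<longlonglongrightarrow> 0" by simp
  then have "eventually (\<lambda>n. prob (?A n) < \<epsilon>) sequentially"
    using \<open>\<epsilon> > 0\<close> by (rule order_tendstoD(2))
  then obtain N where "\<And>n. n \<ge> N \<Longrightarrow> prob (?A n) < \<epsilon>"
    by (auto simp: eventually_sequentially)
  then show "\<exists>K>0. \<exists>N>0. \<forall>n>N. prob {\<omega> \<in> space M. \<bar>X n \<omega>\<bar> > K} < \<epsilon>"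
    by (intro exI[of _ 1] exI[of _ "Suc N"] conjI) auto
qed

text \<open>The expectation of the series is at most \<open>suminf c\<close>, uniformly in
  \<open>n\<close>, and Markov's inequality turns this into a tail bound.\<close>

lemma bigOp_0_suminf:
  fixes f :: "nat \<Rightarrow> nat \<Rightarrow> 'a \<Rightarrow> real"
  assumes int: "\<And>n j. n > 0 \<Longrightarrow> integrable M (f n j)"
    and nonneg: "\<And>n j \<omega>. 0 \<le> f n j \<omega>"
    and sum: "\<And>n \<omega>. n > 0 \<Longrightarrow> \<omega> \<in> space M \<Longrightarrow> summable (\<lambda>j. f n j \<omega>)"
    and le: "\<And>n j. n > 0 \<Longrightarrow> expectation (f n j) \<le> c j" and c: "summable c"
  shows "bigOp M (\<lambda>n \<omega>. \<Sum>j. f n j \<omega>) 0"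
  unfolding bigOp_0_iff
proof (intro allI impI)
  fix \<epsilon> :: real assume "\<epsilon> > 0"
  \<comment> \<open>The added 1 keeps \<open>K\<close> positive and makes
    \<open>suminf c / K < \<epsilon>\<close> strict.\<close>
  define K where "K = (\<bar>suminf c\<bar> + 1) / \<epsilon>"
  have "K > 0" using \<open>\<epsilon> > 0\<close> by (simp add: K_def add_nonneg_pos)
  have "prob {\<omega> \<in> space M. \<bar>\<Sum>j. f n j \<omega>\<bar> > K} < \<epsilon>" if n: "n > 0" for n
  proof -
    have meas [measurable]: "f n j \<in> borel_measurable M" for j
      using int[OF n] by auto
    have cnn: "0 \<le> c j" for j
      by (rule order_trans[OF _ le[OF n]]) (simp add: nonneg)
    \<comment> \<open>Series and expectation are exchanged for the nonnegative integral, because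
      integrability of the sum is only derived from the resulting bound.\<close>
    have "(\<integral>\<^sup>+ \<omega>. ennreal (\<Sum>j. f n j \<omega>) \<partial>M) = (\<integral>\<^sup>+ \<omega>. (\<Sum>j. ennreal (f n j \<omega>)) \<partial>M)"
      by (rule nn_integral_cong) (simp add: suminf_ennreal2 nonneg sum[OF n])
    also have "\<dots> = (\<Sum>j. \<integral>\<^sup>+ \<omega>. ennreal (f n j \<omega>) \<partial>M)"
      by (rule nn_integral_suminf) measurable
    also have "\<dots> = (\<Sum>j. ennreal (expectation (f n j)))"
      by (simp add: nn_integral_eq_integral[OF int[OF n]] nonneg)
    also have "\<dots> \<le> (\<Sum>j. ennreal (c j))"
      by (intro suminf_le summableI ennreal_leI le n)
    also have "\<dots> = ennreal (suminf c)" by (rule suminf_ennreal2[OF cnn c])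
    finally have nn: "(\<integral>\<^sup>+ \<omega>. ennreal (\<Sum>j. f n j \<omega>) \<partial>M) \<le> ennreal (suminf c)" .
    have pos: "0 \<le> (\<Sum>j. f n j \<omega>)" if "\<omega> \<in> space M" for \<omega>
      by (intro suminf_nonneg sum n that nonneg)
    have F: "integrable M (\<lambda>\<omega>. \<Sum>j. f n j \<omega>)"
      using pos nn by (intro integrableI_nonneg AE_I2) (auto simp: ennreal_less_top intro: le_less_trans)
    have "ennreal (expectation (\<lambda>\<omega>. \<Sum>j. f n j \<omega>)) \<le> ennreal (suminf c)"
      using nn nn_integral_eq_integral[OF F] pos by simp
    then have E: "expectation (\<lambda>\<omega>. \<Sum>j. f n j \<omega>) \<le> suminf c"
      using suminf_nonneg[OF c cnn] by simp
    have "prob {\<omega> \<in> space M. \<bar>\<Sum>j. f n j \<omega>\<bar> > K} \<le> prob {\<omega> \<in> space M. (\<Sum>j. f n j \<omega>) \<ge> K}"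
      using pos by (intro finite_measure_mono) auto
    also have "\<dots> \<le> expectation (\<lambda>\<omega>. \<Sum>j. f n j \<omega>) / K"
      by (rule integral_Markov_inequality_measure[OF F sets.empty_sets]) (use pos \<open>K > 0\<close> in auto)
    also have "\<dots> \<le> suminf c / K" using E \<open>K > 0\<close> by (simp add: divide_right_mono)
    also have "suminf c < \<epsilon> * K" using \<open>\<epsilon> > 0\<close> by (simp add: K_def)
    then have "suminf c / K < \<epsilon>" using \<open>K > 0\<close> by (simp add: pos_divide_less_eq)
    finally show ?thesis .
  qed
  with \<open>K > 0\<close> show "\<exists>K>0. \<exists>N>0. \<forall>n>N. prob {\<omega> \<in> space M. \<bar>\<Sum>j. f n j \<omega>\<bar> > K} < \<epsilon>"
    by (intro exI[of _ K] exI[of _ 1]) auto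
qed

end

section \<open>Consistency and rates of the empirical distribution of an i.i.d. sample\<close>

locale discrete_sample = prob_space M for M :: "'w measure" +
  fixes s :: "nat \<Rightarrow> 's" and p :: "nat \<Rightarrow> real" and z :: "nat \<Rightarrow> 'w \<Rightarrow> 's"
  assumes inj: "inj s" and p: "p \<in> prob_vecs" and iid: "iid_sample M s p z"
begin

abbreviation X :: "nat \<Rightarrow> 'w \<Rightarrow> nat \<Rightarrow> nat" where
  "X n \<omega> \<equiv> freq s z n \<omega>"

lemma z_indep: "indep_vars (\<lambda>_. count_space (range s)) z {1..}"
  using iid by (simp add: iid_sample_def)

lemma z_measurable: "1 \<le> i \<Longrightarrow> z i \<in> measurable M (count_space (range s))"
  using z_indep by (simp add: indep_vars_def)

lemma z_range: "1 \<le> i \<Longrightarrow> \<omega> \<in> space M \<Longrightarrow> z i \<omega> \<in> range s"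
  using measurable_space[OF z_measurable] by simp

lemma z_eq_measurable: "1 \<le> i \<Longrightarrow> {\<omega> \<in> space M. z i \<omega> = s j} \<in> events"
  using measurable_sets[OF z_measurable, of i "{s j}"] by (auto simp: vimage_def Int_def conj_commute)

text \<open>The frequencies depend on the first \<open>n\<close> observations only, which have
  countably many outcomes, coded by index lists \<open>l\<close>. The event is a countable union of
  the outcome events \<open>E l\<close>, so every function of the frequencies is measurable,
  whatever \<open>G\<close> is.\<close>

lemma freq_pred_measurable: "{\<omega> \<in> space M. P (X n \<omega>)} \<in> events"
proof -
  \<comment> \<open>The shift \<open>i - 1\<close> reconciles observations numbered from 1 with list
    positions numbered from 0.\<close>
  define F where "F l j = card {i \<in> {1..n}. s (l ! (i - 1)) = s j}" for l :: "nat list" and j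
  define E where "E l = {\<omega> \<in> space M. \<forall>i\<in>{1..n}. z i \<omega> = s (l ! (i - 1))}" for l :: "nat list"
  have FX: "X n \<omega> = F l" if "\<omega> \<in> E l" for \<omega> l
  proof
    fix j
    have "{i \<in> {1..n}. z i \<omega> = s j} = {i \<in> {1..n}. s (l ! (i - 1)) = s j}"
      using that by (auto simp: E_def)
    then show "X n \<omega> j = F l j" by (simp add: freq_def F_def)
  qed
  have "\<exists>l. \<omega> \<in> E l" if "\<omega> \<in> space M" for \<omega>
  proof
    have "z i \<omega> = s (inv s (z i \<omega>))" if "i \<in> {1..n}" for i
      using z_range[of i \<omega>] that \<open>\<omega> \<in> space M\<close> by (simp add: f_inv_into_f)
    then show "\<omega> \<in> E (map (\<lambda>i. inv s (z i \<omega>)) [1..<Suc n])"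
      using that by (auto simp: E_def nth_append simp del: upt_Suc)
  qed
  moreover have "\<omega> \<in> space M" if "\<omega> \<in> E l" for \<omega> l
    using that by (simp add: E_def)
  ultimately have "{\<omega> \<in> space M. P (X n \<omega>)} = (\<Union>l\<in>{l. P (F l)}. E l)"
    using FX by fastforce
  also have "\<dots> \<in> events"
  proof (rule sets.countable_UN'')
    show "E l \<in> events" for l
      unfolding E_def by (intro sets.sets_Collect_finite_All z_eq_measurable) auto
  qed simp
  finally show ?thesis .
qed

lemma freq_borel_measurable [measurable]:
  fixes \<Phi> :: "(nat \<Rightarrow> nat) \<Rightarrow> real"
  shows "(\<lambda>\<omega>. \<Phi> (X n \<omega>)) \<in> borel_measurable M"
  unfolding borel_measurable_iff_greater by (intro allI freq_pred_measurable)

text \<open>By injectivity of \<open>s\<close> each observation has exactly one index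
  \<open>f i\<close>, so the fibres of \<open>f\<close> partition \<open>{1..n}\<close> and the
  counts add up to \<open>n\<close>.\<close>

lemma freq_data_freq:
  assumes "\<omega> \<in> space M"
  shows "freq_data n (X n \<omega>)"
proof -
  define f where "f i = inv s (z i \<omega>)" for i
  have "z i \<omega> = s j \<longleftrightarrow> f i = j" if "i \<in> {1..n}" for i j
    using z_range[of i \<omega>] assms that inj by (auto simp: f_def inj_eq)
  then have X: "X n \<omega> j = card {i \<in> {1..n}. f i = j}" for j
    unfolding freq_def by (metis (mono_tags, lifting))
  then have eq: "{j. X n \<omega> j > 0} = f ` {1..n}"
    by (auto simp: card_gt_0_iff)
  have "(\<Sum>j\<in>f ` {1..n}. card {i \<in> {1..n}. f i = j}) = card {1..n}"
    using sum.image_gen[of "{1..n}" "\<lambda>_. 1 :: nat" f] by simp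
  then show ?thesis unfolding freq_data_def eq unfolding X by simp
qed

text \<open>The independent centred summands of the estimation error in cell
  \<open>j\<close>.\<close>

definition Y :: "nat \<Rightarrow> nat \<Rightarrow> 'w \<Rightarrow> real" where
  "Y j i \<omega> = indicator {s j} (z i \<omega>) - p j"

lemma Y_indep: "indep_vars (\<lambda>_. borel) (Y j) {1..}"
  unfolding Y_def[abs_def]
  by (rule indep_vars_compose2[OF z_indep]) simp

lemma Y_bounded: "\<bar>Y j i \<omega>\<bar> \<le> 1"
  using prob_vecs_nonneg[OF p, of j] prob_vecs_le_one[OF p, of j]
  by (auto simp: Y_def indicator_def)

lemma Y_sum: "(\<Sum>i\<in>{1..n}. Y j i \<omega>) = real (X n \<omega> j) - real n * p j"
proof -
  have "(\<Sum>i\<in>{1..n}. indicator {s j} (z i \<omega>)) = real (card ({1..n} \<inter> {i. z i \<omega> = s j}))"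
    by (simp add: indicator_def sum.If_cases)
  also have "{1..n} \<inter> {i. z i \<omega> = s j} = {i \<in> {1..n}. z i \<omega> = s j}" by auto
  finally show ?thesis by (simp add: Y_def sum_subtractf freq_def)
qed

lemma expectation_hit:
  assumes "1 \<le> i"
  shows "integrable M (\<lambda>\<omega>. indicator {s j} (z i \<omega>) :: real)"
    and "expectation (\<lambda>\<omega>. indicator {s j} (z i \<omega>)) = p j"
proof -
  have eq: "indicator {s j} (z i \<omega>) = (indicator {\<omega> \<in> space M. z i \<omega> = s j} \<omega> :: real)"
    if "\<omega> \<in> space M" for \<omega>
    using that by (simp add: indicator_def)
  show "integrable M (\<lambda>\<omega>. indicator {s j} (z i \<omega>) :: real)"
    by (subst Bochner_Integration.integrable_cong[OF refl eq])
      (auto simp: z_eq_measurable[OF assms] less_top[symmetric])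
  have "expectation (\<lambda>\<omega>. indicator {s j} (z i \<omega>))
      = expectation (indicator {\<omega> \<in> space M. z i \<omega> = s j} :: 'w \<Rightarrow> real)"
    by (rule Bochner_Integration.integral_cong[OF refl eq])
  also have "\<dots> = p j"
    using iid assms z_eq_measurable[OF assms, of j] by (simp add: iid_sample_def)
  finally show "expectation (\<lambda>\<omega>. indicator {s j} (z i \<omega>)) = p j" .
qed

lemma expectation_Y: "1 \<le> i \<Longrightarrow> expectation (Y j i) = 0"
  unfolding Y_def[abs_def] by (simp add: expectation_hit prob_space)

lemma expectation_Y_squared:
  assumes "1 \<le> i"
  shows "expectation (\<lambda>\<omega>. (Y j i \<omega>)\<^sup>2) \<le> p j"
proof -
  \<comment> \<open>An indicator equals its own square, so the square is affine in it and the mean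
    is the Bernoulli variance.\<close>
  have "(Y j i \<omega>)\<^sup>2 = (1 - 2 * p j) * indicator {s j} (z i \<omega>) + (p j)\<^sup>2" for \<omega>
    by (auto simp: Y_def indicator_def power2_eq_square algebra_simps)
  then have "expectation (\<lambda>\<omega>. (Y j i \<omega>)\<^sup>2) = (1 - 2 * p j) * p j + (p j)\<^sup>2"
    by (simp add: expectation_hit[OF assms] prob_space)
  also have "\<dots> \<le> p j" by (simp add: power2_eq_square algebra_simps)
  finally show ?thesis .
qed

lemma p_hat_minus_p: "0 < n \<Longrightarrow> p_hat n (X n \<omega>) j - p j = (\<Sum>i\<in>{1..n}. Y j i \<omega>) / real n"
  unfolding Y_sum by (simp add: p_hat_def field_simps)

lemma p_hat_integrable:
  "integrable M (\<lambda>\<omega>. (p_hat n (X n \<omega>) j - p j)\<^sup>2)"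
  "integrable M (\<lambda>\<omega>. \<bar>p_hat n (X n \<omega>) j - p j\<bar>)"
proof -
  have le: "\<bar>p_hat n (X n \<omega>) j - p j\<bar> \<le> 1" for \<omega>
  proof -
    have "X n \<omega> j \<le> card {1..n}" unfolding freq_def by (intro card_mono) auto
    then have "p_hat n (X n \<omega>) j \<le> 1" by (cases "n = 0") (simp_all add: p_hat_def)
    moreover have "0 \<le> p_hat n (X n \<omega>) j" by (simp add: p_hat_def)
    ultimately show ?thesis
      using prob_vecs_nonneg[OF p, of j] prob_vecs_le_one[OF p, of j] by auto
  qed
  then show "integrable M (\<lambda>\<omega>. \<bar>p_hat n (X n \<omega>) j - p j\<bar>)"
    by (intro integrable_const_bound[of _ 1]) auto
  have "(p_hat n (X n \<omega>) j - p j)\<^sup>2 \<le> 1" for \<omega>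
    using le by (simp add: abs_square_le_1)
  then show "integrable M (\<lambda>\<omega>. (p_hat n (X n \<omega>) j - p j)\<^sup>2)"
    by (intro integrable_const_bound[of _ 1]) auto
qed

lemma p_hat_mean_square:
  assumes "0 < n"
  shows "expectation (\<lambda>\<omega>. (p_hat n (X n \<omega>) j - p j)\<^sup>2) \<le> p j / real n"
proof -
  have "expectation (\<lambda>\<omega>. (\<Sum>i\<in>{1..n}. Y j i \<omega>)\<^sup>2) \<le> real (card {1..n}) * p j"
    by (rule expectation_sum_squared_le[where B = 1])
      (auto intro: indep_vars_subset[OF Y_indep] simp: Y_bounded expectation_Y expectation_Y_squared)
  then have "expectation (\<lambda>\<omega>. (\<Sum>i\<in>{1..n}. Y j i \<omega>)\<^sup>2) / (real n)\<^sup>2 \<le> real n * p j / (real n)\<^sup>2"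
    by (intro divide_right_mono) auto
  then show ?thesis
    using assms by (simp add: p_hat_minus_p power_divide power2_eq_square)
qed

text \<open>Jensen's inequality in the form that the variance of the absolute error is
  nonnegative.\<close>

lemma p_hat_mean_abs:
  assumes "0 < n"
  shows "expectation (\<lambda>\<omega>. \<bar>p_hat n (X n \<omega>) j - p j\<bar>) \<le> sqrt (p j / real n)"
proof (rule real_le_rsqrt)
  let ?D = "\<lambda>\<omega>. \<bar>p_hat n (X n \<omega>) j - p j\<bar>"
  have "0 \<le> variance ?D" by (rule variance_positive)
  also have "\<dots> = expectation (\<lambda>\<omega>. (?D \<omega>)\<^sup>2) - (expectation ?D)\<^sup>2"
    by (rule variance_eq) (use p_hat_integrable in simp_all)
  finally show "(expectation ?D)\<^sup>2 \<le> p j / real n"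
    using p_hat_mean_square[OF assms, of j] by simp
qed

text \<open>Strong law in all cells at once: Hoeffding's inequality makes the deviation
  probabilities summable, and the Borel-Cantelli lemma applies for each cell and radius.\<close>

lemma p_hat_AE_tendsto: "AE \<omega> in M. \<forall>j. (\<lambda>n. p_hat n (X n \<omega>) j) \<longlonglongrightarrow> p j"
proof -
  have AE: "AE \<omega> in M. eventually (\<lambda>n. \<omega> \<in> space M - {\<omega> \<in> space M. \<bar>p_hat n (X n \<omega>) j - p j\<bar> \<ge> e}) sequentially"
    if e: "e > 0" for j and e :: real
  proof (rule borel_cantelli_AE1)
    have bound: "prob {\<omega> \<in> space M. \<bar>p_hat n (X n \<omega>) j - p j\<bar> \<ge> e} \<le> 2 * exp (- e\<^sup>2 / 2) ^ n"
      if n: "n \<ge> 1" for n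
    proof -
      \<comment> \<open>The summands lie in an interval of length 2, so the exponent is
        \<open>- 2 * (n * e)\<^sup>2 / (4 * n) = - n * e\<^sup>2 / 2\<close>.\<close>
      interpret H: Hoeffding_ineq M "{1..n}" "Y j" "\<lambda>_. - 1" "\<lambda>_. 1" "\<Sum>i\<in>{1..n}. expectation (Y j i)"
      proof unfold_locales
        show "indep_vars (\<lambda>_. borel) (Y j) {1..n}"
          by (rule indep_vars_subset[OF Y_indep]) auto
        show "AE \<omega> in M. Y j i \<omega> \<in> {- 1..1}" for i
          using Y_bounded[of j i] by (auto simp: abs_le_iff minus_le_iff)
      qed simp_all
      have "{\<omega> \<in> space M. \<bar>p_hat n (X n \<omega>) j - p j\<bar> \<ge> e}
          = {\<omega> \<in> space M. \<bar>(\<Sum>i\<in>{1..n}. Y j i \<omega>) - (\<Sum>i\<in>{1..n}. expectation (Y j i))\<bar> \<ge> real n * e}"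
        using n by (intro Collect_cong conj_cong refl)
          (simp add: expectation_Y p_hat_minus_p field_simps del: sum.cl_ivl_Suc)
      also have "prob \<dots> \<le> 2 * exp (- 2 * (real n * e)\<^sup>2 / (\<Sum>i\<in>{1..n}. (1 - (- 1))\<^sup>2))"
        by (rule H.Hoeffding_ineq_abs_ge) (use n e in auto)
      also have "- 2 * (real n * e)\<^sup>2 / (\<Sum>i\<in>{1..n}. (1 - (- 1))\<^sup>2) = real n * (- e\<^sup>2 / 2)"
        using n by (simp add: power2_eq_square field_simps)
      finally show ?thesis by (simp only: exp_of_nat_mult)
    qed
    have "exp (- e\<^sup>2 / 2) < 1" using e by simp
    then have "summable (\<lambda>n. 2 * exp (- e\<^sup>2 / 2) ^ n)"
      by (intro summable_mult summable_geometric) simp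
    then show "summable (\<lambda>n. prob {\<omega> \<in> space M. \<bar>p_hat n (X n \<omega>) j - p j\<bar> \<ge> e})"
      by (rule summable_comparison_test'[where N = 1]) (use bound in simp)
  qed (simp_all add: emeasure_eq_measure)
  \<comment> \<open>Restricting to the radii \<open>1 / (m + 1)\<close> leaves countably many
    conditions, which share one null set.\<close>
  have "AE \<omega> in M. \<forall>j m. eventually (\<lambda>n. \<bar>p_hat n (X n \<omega>) j - p j\<bar> < 1 / real (Suc m)) sequentially"
    unfolding AE_all_countable
  proof (intro allI)
    fix j m
    have "0 < 1 / real (Suc m)" by simp
    from AE[OF this, of j] show "AE \<omega> in M. eventually (\<lambda>n. \<bar>p_hat n (X n \<omega>) j - p j\<bar> < 1 / real (Suc m)) sequentially"
      by eventually_elim (auto elim!: eventually_mono)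
  qed
  then show ?thesis
  proof eventually_elim
    case (elim \<omega>)
    show ?case
    proof (intro allI tendstoI)
      fix j and e :: real assume "e > 0"
      then obtain m where m: "1 / real (Suc m) < e" using nat_approx_posE by blast
      from elim have "eventually (\<lambda>n. \<bar>p_hat n (X n \<omega>) j - p j\<bar> < 1 / real (Suc m)) sequentially" by simp
      then show "eventually (\<lambda>n. dist (p_hat n (X n \<omega>) j) (p j) < e) sequentially"
        by eventually_elim (use m in \<open>simp add: dist_real_def\<close>)
    qed
  qed
qed

lemma p_hat_prob_vecs: "0 < n \<Longrightarrow> \<omega> \<in> space M \<Longrightarrow> p_hat n (X n \<omega>) \<in> prob_vecs"
  using freq_data_p_hat[OF freq_data_freq] by simp

text \<open>Scaled by \<open>sqrt n\<close>, the mean absolute error in cell \<open>j\<close> is at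
  most \<open>sqrt (p j)\<close>, so these form the dominating series.\<close>

lemma p_hat_rate_one:
  assumes "summable (\<lambda>j. sqrt (p j))"
  shows "bigOp M (\<lambda>n \<omega>. sqrt (real n) * lnorm 1 (p_hat n (X n \<omega>) - p)) 0"
proof -
  define f where "f n j \<omega> = sqrt (real n) * \<bar>p_hat n (X n \<omega>) j - p j\<bar>" for n j \<omega>
  have sum: "summable (\<lambda>j. \<bar>p_hat n (X n \<omega>) j - p j\<bar>)" if "0 < n" "\<omega> \<in> space M" for n \<omega>
    by (rule prob_vecs_diff_summable[OF p_hat_prob_vecs[OF that] p])
  have "bigOp M (\<lambda>n \<omega>. \<Sum>j. f n j \<omega>) 0"
  proof (rule bigOp_0_suminf[OF _ _ _ _ assms])
    show "expectation (f n j) \<le> sqrt (p j)" if "0 < n" for n j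
    proof -
      have "expectation (f n j) \<le> sqrt (real n) * sqrt (p j / real n)"
        unfolding f_def using p_hat_mean_abs[OF that] by (simp add: mult_left_mono)
      also have "\<dots> = sqrt (p j)" using that by (simp flip: real_sqrt_mult)
      finally show ?thesis .
    qed
  qed (simp_all add: f_def p_hat_integrable sum summable_mult)
  then show ?thesis
  proof (rule bigOp_0_le_add[OF _ bigOp_0_const[of 0]])
    show "\<bar>sqrt (real n) * lnorm 1 (p_hat n (X n \<omega>) - p)\<bar> \<le> \<bar>\<Sum>j. f n j \<omega>\<bar> + \<bar>0\<bar>"
      if "n > 0" "\<omega> \<in> space M" for n \<omega>
      using sum[OF that] by (simp add: f_def lnorm_one suminf_mult)
  qed (simp_all add: f_def)
qed

text \<open>The squared norm times \<open>n\<close> is a series whose terms have mean at most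
  \<open>p j\<close>; the square root is removed by \<open>sqrt S \<le> S + 1\<close>.\<close>

lemma p_hat_rate_two: "bigOp M (\<lambda>n \<omega>. sqrt (real n) * lnorm 2 (p_hat n (X n \<omega>) - p)) 0"
proof -
  define f where "f n j \<omega> = real n * (p_hat n (X n \<omega>) j - p j)\<^sup>2" for n j \<omega>
  have sum: "summable (\<lambda>j. (p_hat n (X n \<omega>) j - p j)\<^sup>2)" if "0 < n" "\<omega> \<in> space M" for n \<omega>
    using summable_abs_power[OF prob_vecs_diff_summable[OF p_hat_prob_vecs[OF that] p], of 2] by simp
  have "bigOp M (\<lambda>n \<omega>. \<Sum>j. f n j \<omega>) 0"
  proof (rule bigOp_0_suminf[OF _ _ _ _ prob_vecs_summable[OF p]])
    show "expectation (f n j) \<le> p j" if "0 < n" for n j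
      unfolding f_def using p_hat_mean_square[OF that, of j] that by (simp add: field_simps)
  qed (simp_all add: f_def p_hat_integrable sum summable_mult)
  then show ?thesis
  proof (rule bigOp_0_le_add[OF _ bigOp_0_const[of 1]])
    show "\<bar>sqrt (real n) * lnorm 2 (p_hat n (X n \<omega>) - p)\<bar> \<le> \<bar>\<Sum>j. f n j \<omega>\<bar> + \<bar>1\<bar>"
      if "n > 0" "\<omega> \<in> space M" for n \<omega>
    proof -
      define S where "S = (\<Sum>j. f n j \<omega>)"
      have S: "S = real n * (\<Sum>j. (p_hat n (X n \<omega>) j - p j)\<^sup>2)"
        unfolding S_def f_def by (rule suminf_mult[OF sum[OF that]])
      have "0 \<le> S" unfolding S by (simp add: suminf_nonneg sum[OF that])
      moreover have "sqrt S \<le> S + 1"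
        using arith_geo_mean_sqrt[of S 1] \<open>0 \<le> S\<close> by simp
      moreover have "sqrt (real n) * lnorm 2 (p_hat n (X n \<omega>) - p) = sqrt S"
        by (simp add: S lnorm_two real_sqrt_mult)
      ultimately show ?thesis by (simp add: S_def)
    qed
  qed (simp_all add: f_def)
qed

end

section \<open>The stacked estimator\<close>

theorem theorem3:
  fixes M :: "'w measure"
    and s :: "nat \<Rightarrow> 's"
    and z :: "nat \<Rightarrow> 'w \<Rightarrow> 's"
    and p :: "nat \<Rightarrow> real"
    and G :: "(nat \<Rightarrow> real) \<Rightarrow> nat \<Rightarrow> real"
    and d :: loss
  assumes M: "prob_space M"
    and s: "inj s"
    and p: "p \<in> prob_vecs"
    and z: "iid_sample M s p z"
    and maps: "\<And>f. f \<in> prob_vecs \<Longrightarrow> G f \<in> prob_vecs"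
    and continuous: "\<And>f \<epsilon>. f \<in> prob_vecs \<Longrightarrow> \<epsilon> > 0 \<Longrightarrow>
          \<exists>\<delta>>0. \<forall>h\<in>prob_vecs. lnorm 2 (h - f) < \<delta> \<longrightarrow> lnorm 2 (G h - G f) < \<epsilon>"
    and contraction: "\<And>f h. f \<in> prob_vecs \<Longrightarrow> h \<in> prob_vecs \<Longrightarrow>
          lnorm \<infinity> (G f - G h) \<le> lnorm \<infinity> (f - h)"
    and orthogonal: "\<And>f. f \<in> prob_vecs \<Longrightarrow> linner (G f) (f - G f) = 0"
    and nonneg: "\<And>f. f \<in> prob_vecs \<Longrightarrow> linner f (f - G f) \<ge> 0"
    and leave_one_out: "\<exists>c :: nat \<Rightarrow> real. c \<longlonglongrightarrow> 1 \<and>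
          (\<forall>n\<ge>2. \<forall>x. freq_data n x \<longrightarrow>
             (\<forall>j. c n * (if x j > 0 then G (p_loo n x j) j else 0) \<le> G (p_hat n x) j))"
    and rate: "\<And>k. G p = p \<Longrightarrow> 2 \<le> k \<Longrightarrow>
          bigOp M (\<lambda>n \<omega>. sqrt (real n) * lnorm k (G (p_hat n (freq s z n \<omega>)) - p)) 0"
    and rate_l1: "G p = p \<Longrightarrow> summable (\<lambda>j. sqrt (p j)) \<Longrightarrow>
          bigOp M (\<lambda>n \<omega>. sqrt (real n) * lnorm 1 (G (p_hat n (freq s z n \<omega>)) - p)) 0"
  shows "(\<forall>k\<ge>1. AE \<omega> in M.
            (\<lambda>n. lnorm k (stacked d G n (freq s z n \<omega>) - p)) \<longlonglongrightarrow> 0)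
       \<and> (\<forall>k\<ge>2. bigOp M (\<lambda>n \<omega>. sqrt (real n) * lnorm k (stacked d G n (freq s z n \<omega>) - p)) 0)
       \<and> (summable (\<lambda>j. sqrt (p j)) \<longrightarrow>
            bigOp M (\<lambda>n \<omega>. sqrt (real n) * lnorm 1 (stacked d G n (freq s z n \<omega>) - p)) 0)"
proof -
  interpret discrete_sample M s p z
    by (intro discrete_sample.intro discrete_sample_axioms.intro M s p z)
  interpret linf_contraction G
    by (intro linf_contraction.intro maps contraction)
  let ?\<phi> = "\<lambda>n \<omega>. stacked d G n (X n \<omega>)"
  have diff: "summable (\<lambda>j. \<bar>(?\<phi> n \<omega> - p) j\<bar>)" if "0 < n" "\<omega> \<in> space M" for n \<omega>
    using prob_vecs_diff_summable[OF stacked_prob_vecs[OF freq_data_freq[OF that(2)], of n d] p] that(1)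
    by simp
  have stacked_le:
    "lnorm l (?\<phi> n \<omega> - p) \<le> lnorm l (p_hat n (X n \<omega>) - p) + lnorm l (G (p_hat n (X n \<omega>)) - p)"
    "lnorm l (?\<phi> n \<omega> - p) \<le> lnorm l (p_hat n (X n \<omega>) - p) + 2 * beta d G n (X n \<omega>)"
    if "0 < n" "\<omega> \<in> space M" "l = 1 \<or> l = 2" for n \<omega> l
    using lnorm_stacked_le[OF freq_data_freq[OF that(2)] _ p that(3), of n d] that(1) by auto
  have antimono: "0 \<le> lnorm k (?\<phi> n \<omega> - p) \<and> lnorm k (?\<phi> n \<omega> - p) \<le> lnorm l (?\<phi> n \<omega> - p)"
    if "0 < n" "\<omega> \<in> space M" "1 \<le> l" "l \<le> k" for n \<omega> k l
    using lnorm_antimono[OF diff[OF that(1,2)] that(3,4)]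
      lnorm_nonneg[OF diff[OF that(1,2)] order_trans[OF that(3,4)]] by (simp add: fun_diff_def)
  \<comment> \<open>Deterministic along each sample path on which the empirical distribution
    converges cellwise.\<close>
  have beta_lim: "(\<lambda>n. sqrt (real n) * beta d G n (X n \<omega>)) \<longlonglongrightarrow> 0"
    if "G p \<noteq> p" "\<omega> \<in> space M" "\<And>j. (\<lambda>n. p_hat n (X n \<omega>) j) \<longlonglongrightarrow> p j" for \<omega>
    by (rule sqrt_beta_tendsto_0[OF p freq_data_freq[OF that(2)] that(3) that(1) orthogonal[OF p]])

  have strong: "AE \<omega> in M. (\<lambda>n. lnorm 1 (?\<phi> n \<omega> - p)) \<longlonglongrightarrow> 0"
    using p_hat_AE_tendsto AE_space
  proof eventually_elim
    case (elim \<omega>)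
    note x = freq_data_freq[OF elim(2)] and lim = elim(1)[rule_format]
    have ph: "p_hat n (X n \<omega>) \<in> prob_vecs" if "n \<ge> 1" for n
      by (rule freq_data_p_hat[OF x that])
    have N1: "(\<lambda>n. lnorm 1 (\<lambda>j. p_hat n (X n \<omega>) j - p j)) \<longlonglongrightarrow> 0"
      by (rule prob_vecs_tendsto_lnorm_one[OF ph p lim])
    \<comment> \<open>\<open>B\<close> is the excess over the empirical error: the l_1-error of
      \<open>G p_hat\<close> if \<open>G p = p\<close>, and a multiple of the scaled weight
      otherwise.\<close>
    have "\<exists>B. B \<longlonglongrightarrow> 0 \<and> (\<forall>n\<ge>1. lnorm 1 (?\<phi> n \<omega> - p) \<le> lnorm 1 (\<lambda>j. p_hat n (X n \<omega>) j - p j) + B n)"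
    proof (cases "G p = p")
      case True
      have "(\<lambda>n. G (p_hat n (X n \<omega>)) j) \<longlonglongrightarrow> p j" for j
        by (rule G_tendsto[OF ph p N1, unfolded True])
      from prob_vecs_tendsto_lnorm_one[OF maps[OF ph] p this] show ?thesis
        using stacked_le(1)[OF _ elim(2), of _ 1]
        by (intro exI[of _ "\<lambda>n. lnorm 1 (\<lambda>j. G (p_hat n (X n \<omega>)) j - p j)"]) (auto simp: fun_diff_def)
    next
      case False
      have "(\<lambda>n. 2 * (sqrt (real n) * beta d G n (X n \<omega>))) \<longlonglongrightarrow> 0"
        using tendsto_mult_right_zero[OF beta_lim[OF False elim(2) lim]] .
      moreover have "lnorm 1 (?\<phi> n \<omega> - p)
          \<le> lnorm 1 (\<lambda>j. p_hat n (X n \<omega>) j - p j) + 2 * (sqrt (real n) * beta d G n (X n \<omega>))"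
        if n: "n \<ge> 1" for n
      proof -
        \<comment> \<open>For \<open>n \<ge> 1\<close> the factor \<open>sqrt n\<close> is at least
          1, so inserting it only enlarges the bound and \<open>beta_lim\<close> becomes
          applicable.\<close>
        have "1 * beta d G n (X n \<omega>) \<le> sqrt (real n) * beta d G n (X n \<omega>)"
          using n beta_bounds(1) by (intro mult_right_mono) auto
        then show ?thesis
          using stacked_le(2)[OF _ elim(2), of n 1] n by (simp add: fun_diff_def)
      qed
      ultimately show ?thesis by blast
    qed
    then obtain B where B: "B \<longlonglongrightarrow> 0"
      "\<And>n. n \<ge> 1 \<Longrightarrow> lnorm 1 (?\<phi> n \<omega> - p) \<le> lnorm 1 (\<lambda>j. p_hat n (X n \<omega>) j - p j) + B n"
      by blast
    have "eventually (\<lambda>n. norm (lnorm 1 (?\<phi> n \<omega> - p))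
        \<le> lnorm 1 (\<lambda>j. p_hat n (X n \<omega>) j - p j) + B n) sequentially"
      using eventually_ge_at_top[of 1]
    proof eventually_elim
      case (elim n)
      with B(2)[OF elim] antimono[of n \<omega> 1 1] \<open>\<omega> \<in> space M\<close> show ?case by simp
    qed
    then show ?case
      by (rule Lim_null_comparison) (use tendsto_add[OF N1 B(1)] in simp)
  qed

  have a: "AE \<omega> in M. (\<lambda>n. lnorm k (?\<phi> n \<omega> - p)) \<longlonglongrightarrow> 0" if "1 \<le> k" for k
    using strong AE_space
  proof eventually_elim
    case (elim \<omega>)
    have "eventually (\<lambda>n. norm (lnorm k (?\<phi> n \<omega> - p)) \<le> lnorm 1 (?\<phi> n \<omega> - p)) sequentially"
      using eventually_gt_at_top[of 0]
    proof eventually_elim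
      case (elim n)
      with antimono[of n \<omega> 1 k] \<open>\<omega> \<in> space M\<close> that show ?case by simp
    qed
    then show ?case by (rule Lim_null_comparison[OF _ elim(1)])
  qed

  \<comment> \<open>One argument for both rates: \<open>l = 2\<close> yields all exponents
    \<open>k \<ge> 2\<close>, and \<open>l = 1\<close> yields the l_1-rate.\<close>
  have rates: "bigOp M (\<lambda>n \<omega>. sqrt (real n) * lnorm k (?\<phi> n \<omega> - p)) 0"
    if l: "l = 1 \<or> l = 2" "l \<le> k"
      and emp: "bigOp M (\<lambda>n \<omega>. sqrt (real n) * lnorm l (p_hat n (X n \<omega>) - p)) 0"
      and fixpoint: "G p = p \<Longrightarrow> bigOp M (\<lambda>n \<omega>. sqrt (real n) * lnorm l (G (p_hat n (X n \<omega>)) - p)) 0"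
    for k l
  proof -
    have l1: "1 \<le> l" using l(1) by auto
    have meas: "(\<lambda>\<omega>. sqrt (real n) * lnorm l (p_hat n (X n \<omega>) - p)) \<in> borel_measurable M"
      "(\<lambda>\<omega>. sqrt (real n) * lnorm l (G (p_hat n (X n \<omega>)) - p)) \<in> borel_measurable M"
      "(\<lambda>\<omega>. 2 * (sqrt (real n) * beta d G n (X n \<omega>))) \<in> borel_measurable M" for n
      by (rule freq_borel_measurable)+
    show ?thesis
    proof (cases "G p = p")
      case True
      show ?thesis
      proof (rule bigOp_0_le_add[OF emp fixpoint[OF True] meas(1,2), of 0])
        fix n :: nat and \<omega> assume n: "0 < n" "\<omega> \<in> space M"
        have "sqrt (real n) * lnorm k (?\<phi> n \<omega> - p)
            \<le> sqrt (real n) * (lnorm l (p_hat n (X n \<omega>) - p) + lnorm l (G (p_hat n (X n \<omega>)) - p))"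
          using antimono[OF n l1 l(2)] stacked_le(1)[OF n l(1)] by (intro mult_left_mono) auto
        moreover have "0 \<le> sqrt (real n) * lnorm k (?\<phi> n \<omega> - p)"
          using antimono[OF n l1 l(2)] by simp
        ultimately show "\<bar>sqrt (real n) * lnorm k (?\<phi> n \<omega> - p)\<bar>
            \<le> \<bar>sqrt (real n) * lnorm l (p_hat n (X n \<omega>) - p)\<bar> + \<bar>sqrt (real n) * lnorm l (G (p_hat n (X n \<omega>)) - p)\<bar>"
          unfolding distrib_left by linarith
      qed
    next
      case False
      \<comment> \<open>Off the fixed points the scaled weight tends to 0 almost surely, hence is
        bounded in probability.\<close>
      have "AE \<omega> in M. (\<lambda>n. 2 * (sqrt (real n) * beta d G n (X n \<omega>))) \<longlonglongrightarrow> 0"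
        using p_hat_AE_tendsto AE_space
        by eventually_elim (intro tendsto_mult_right_zero beta_lim False, auto)
      then have weight: "bigOp M (\<lambda>n \<omega>. 2 * (sqrt (real n) * beta d G n (X n \<omega>))) 0"
        by (rule AE_tendsto_0_imp_bigOp_0[OF meas(3)])
      show ?thesis
      proof (rule bigOp_0_le_add[OF emp weight meas(1,3), of 0])
        fix n :: nat and \<omega> assume n: "0 < n" "\<omega> \<in> space M"
        have "sqrt (real n) * lnorm k (?\<phi> n \<omega> - p)
            \<le> sqrt (real n) * (lnorm l (p_hat n (X n \<omega>) - p) + 2 * beta d G n (X n \<omega>))"
          using antimono[OF n l1 l(2)] stacked_le(2)[OF n l(1)] by (intro mult_left_mono) auto
        moreover have "0 \<le> sqrt (real n) * lnorm k (?\<phi> n \<omega> - p)"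
          using antimono[OF n l1 l(2)] by simp
        ultimately show "\<bar>sqrt (real n) * lnorm k (?\<phi> n \<omega> - p)\<bar>
            \<le> \<bar>sqrt (real n) * lnorm l (p_hat n (X n \<omega>) - p)\<bar> + \<bar>2 * (sqrt (real n) * beta d G n (X n \<omega>))\<bar>"
          unfolding distrib_left mult.left_commute[of "sqrt (real n)" 2] by linarith
      qed
    qed
  qed
  have b: "bigOp M (\<lambda>n \<omega>. sqrt (real n) * lnorm k (?\<phi> n \<omega> - p)) 0" if "2 \<le> k" for k
    by (rule rates[OF _ that p_hat_rate_two rate]) auto
  have c: "bigOp M (\<lambda>n \<omega>. sqrt (real n) * lnorm 1 (?\<phi> n \<omega> - p)) 0"
    if "summable (\<lambda>j. sqrt (p j))"
    by (rule rates[OF _ order_refl p_hat_rate_one[OF that] rate_l1[OF _ that]]) auto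
  show ?thesis using a b c by blast
qed

end
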